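(* Let $S$ be a commutative ring, let $\mathcal C$ be a small category, and let $\mathscr F\colon\mathcal C\to S\text{-}\mathsf{Mod}$ be a functor such that the $S$-module $\mathscr F(x)$ is artinian for each object $x$ of $\mathcal C$. Then $\mathscr F$ decomposes, in the category $[\mathcal C,S\text{-}\mathsf{Mod}]$, into a direct sum of strongly indecomposable functors.
   Context: $[\mathcal C,S\text{-}\mathsf{Mod}]$ is the category of functors $\mathcal C\to S\text{-}\mathsf{Mod}$ with natural transformations as morphisms. An object of an additive category is strongly indecomposable if its endomorphism ring is local. *)

theory Defs
  imports "HOL-Algebra.Algebra"
begin

section \<open>Modules\<close>

definition mod_hom ::
  "('s, 't) ring_scheme \<Rightarrow> ('s, 'm, 'u) module_scheme \<Rightarrow> ('s, 'n, 'v) module_scheme \<Rightarrow> ('m \<Rightarrow> 'n) set"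
  where "mod_hom S M N =
    {h \<in> hom (add_monoid M) (add_monoid N).
       \<forall>a\<in>carrier S. \<forall>m\<in>carrier M. h (a \<odot>\<^bsub>M\<^esub> m) = a \<odot>\<^bsub>N\<^esub> h m}"

definition artinian_module :: "('s, 't) ring_scheme \<Rightarrow> ('s, 'm, 'u) module_scheme \<Rightarrow> bool"
  where "artinian_module S M \<longleftrightarrow> module S M \<and>
    (\<forall>N :: nat \<Rightarrow> 'm set. (\<forall>k. submodule (N k) S M) \<and> (\<forall>k. N (Suc k) \<subseteq> N k)
       \<longrightarrow> (\<exists>n. \<forall>k\<ge>n. N k = N n))"

text \<open>The fields \<open>mult\<close> and \<open>one\<close> are inherited by the record of modules from that of rings
  and play no role for modules.\<close>

definition module_direct_sum :: "'i set \<Rightarrow> ('i \<Rightarrow> ('s, 'm) module) \<Rightarrow> ('s, 'i \<Rightarrow> 'm) module"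
  where "module_direct_sum I M =
    \<lparr>carrier = {v \<in> (\<Pi>\<^sub>E i\<in>I. carrier (M i)). finite {i \<in> I. v i \<noteq> \<zero>\<^bsub>M i\<^esub>}},
     monoid.mult = (\<lambda>_ _. undefined), one = undefined,
     ring.zero = (\<lambda>i\<in>I. \<zero>\<^bsub>M i\<^esub>),
     ring.add = (\<lambda>v w. \<lambda>i\<in>I. v i \<oplus>\<^bsub>M i\<^esub> w i),
     smult = (\<lambda>a v. \<lambda>i\<in>I. a \<odot>\<^bsub>M i\<^esub> v i)\<rparr>"


section \<open>Local rings\<close>

text \<open>A not necessarily commutative ring is local if its non-units form a two-sided ideal. The
  zero ring is not local, as its only element is a unit and the empty set is no ideal.\<close>

definition local_ring :: "('r, 't) ring_scheme \<Rightarrow> bool"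
  where "local_ring R \<longleftrightarrow> ring R \<and> ideal (carrier R - Units R) R"


section \<open>Small categories and module-valued functors\<close>

record ('o, 'a) cat =
  Ob :: "'o set"
  Ar :: "'a set"
  Dom :: "'a \<Rightarrow> 'o"
  Cod :: "'a \<Rightarrow> 'o"
  Idn :: "'o \<Rightarrow> 'a"
  Cmp :: "'a \<Rightarrow> 'a \<Rightarrow> 'a"  \<comment> \<open>\<open>Cmp C g f\<close> is \<open>g\<close> after \<open>f\<close>\<close>

locale small_category =
  fixes C :: "('o, 'a) cat"
  assumes Dom_closed: "f \<in> Ar C \<Longrightarrow> Dom C f \<in> Ob C"
    and Cod_closed: "f \<in> Ar C \<Longrightarrow> Cod C f \<in> Ob C"
    and Idn_closed: "x \<in> Ob C \<Longrightarrow> Idn C x \<in> Ar C"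
    and Dom_Idn: "x \<in> Ob C \<Longrightarrow> Dom C (Idn C x) = x"
    and Cod_Idn: "x \<in> Ob C \<Longrightarrow> Cod C (Idn C x) = x"
    and Cmp_closed: "\<lbrakk>f \<in> Ar C; g \<in> Ar C; Cod C f = Dom C g\<rbrakk> \<Longrightarrow> Cmp C g f \<in> Ar C"
    and Dom_Cmp: "\<lbrakk>f \<in> Ar C; g \<in> Ar C; Cod C f = Dom C g\<rbrakk> \<Longrightarrow> Dom C (Cmp C g f) = Dom C f"
    and Cod_Cmp: "\<lbrakk>f \<in> Ar C; g \<in> Ar C; Cod C f = Dom C g\<rbrakk> \<Longrightarrow> Cod C (Cmp C g f) = Cod C g"
    and Cmp_Idn_right: "f \<in> Ar C \<Longrightarrow> Cmp C f (Idn C (Dom C f)) = f"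
    and Cmp_Idn_left: "f \<in> Ar C \<Longrightarrow> Cmp C (Idn C (Cod C f)) f = f"
    and Cmp_assoc: "\<lbrakk>f \<in> Ar C; g \<in> Ar C; h \<in> Ar C; Cod C f = Dom C g; Cod C g = Dom C h\<rbrakk>
      \<Longrightarrow> Cmp C h (Cmp C g f) = Cmp C (Cmp C h g) f"

text \<open>The elements of all modules \<open>fob F x\<close> are taken from one type \<open>'m\<close>. As the category is
  small, this is no restriction: \<open>'m\<close> can contain their disjoint union.\<close>

record ('o, 'a, 's, 'm) mod_functor =
  fob :: "'o \<Rightarrow> ('s, 'm) module"
  far :: "'a \<Rightarrow> 'm \<Rightarrow> 'm"

locale module_functor = small_category C + cring S
  for C :: "('o, 'a) cat" and S :: "('s, 't) ring_scheme" +
  fixes F :: "('o, 'a, 's, 'm) mod_functor"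
  assumes fob_module: "x \<in> Ob C \<Longrightarrow> module S (fob F x)"
    and far_hom: "f \<in> Ar C \<Longrightarrow> far F f \<in> mod_hom S (fob F (Dom C f)) (fob F (Cod C f))"
    and far_Idn: "\<lbrakk>x \<in> Ob C; m \<in> carrier (fob F x)\<rbrakk> \<Longrightarrow> far F (Idn C x) m = m"
    and far_Cmp: "\<lbrakk>f \<in> Ar C; g \<in> Ar C; Cod C f = Dom C g; m \<in> carrier (fob F (Dom C f))\<rbrakk>
      \<Longrightarrow> far F (Cmp C g f) m = far F g (far F f m)"


section \<open>The functor category\<close>

text \<open>Natural transformations and their components are extensional, that is, \<open>undefined\<close> outside
  the objects of \<open>C\<close> and the carriers of the modules, so that equality in HOL coincides with
  equality of natural transformations.\<close>

definition nat_trans ::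
  "('o, 'a) cat \<Rightarrow> ('s, 't) ring_scheme \<Rightarrow> ('o, 'a, 's, 'm) mod_functor \<Rightarrow> ('o, 'a, 's, 'n) mod_functor
    \<Rightarrow> ('o \<Rightarrow> 'm \<Rightarrow> 'n) set"
  where "nat_trans C S F G =
    {\<eta> \<in> (\<Pi>\<^sub>E x\<in>Ob C. mod_hom S (fob F x) (fob G x) \<inter> extensional (carrier (fob F x))).
       \<forall>f\<in>Ar C. \<forall>m\<in>carrier (fob F (Dom C f)).
         \<eta> (Cod C f) (far F f m) = far G f (\<eta> (Dom C f) m)}"

definition nt_id ::
  "('o, 'a) cat \<Rightarrow> ('o, 'a, 's, 'm) mod_functor \<Rightarrow> 'o \<Rightarrow> 'm \<Rightarrow> 'm"
  where "nt_id C F = (\<lambda>x\<in>Ob C. \<lambda>m\<in>carrier (fob F x). m)"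

text \<open>\<open>nt_comp C F \<theta> \<eta>\<close> is the composite \<open>\<theta>\<close> after \<open>\<eta>\<close>, where \<open>F\<close> is the source of \<open>\<eta>\<close>.\<close>

definition nt_comp ::
  "('o, 'a) cat \<Rightarrow> ('o, 'a, 's, 'm) mod_functor \<Rightarrow> ('o \<Rightarrow> 'n \<Rightarrow> 'p) \<Rightarrow> ('o \<Rightarrow> 'm \<Rightarrow> 'n) \<Rightarrow> 'o \<Rightarrow> 'm \<Rightarrow> 'p"
  where "nt_comp C F \<theta> \<eta> = (\<lambda>x\<in>Ob C. compose (carrier (fob F x)) (\<theta> x) (\<eta> x))"

definition functor_iso ::
  "('o, 'a) cat \<Rightarrow> ('s, 't) ring_scheme \<Rightarrow> ('o, 'a, 's, 'm) mod_functor \<Rightarrow> ('o, 'a, 's, 'n) mod_functor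
    \<Rightarrow> bool"
  where "functor_iso C S F G \<longleftrightarrow>
    (\<exists>\<eta>\<in>nat_trans C S F G. \<exists>\<theta>\<in>nat_trans C S G F.
       nt_comp C F \<theta> \<eta> = nt_id C F \<and> nt_comp C G \<eta> \<theta> = nt_id C G)"

definition end_ring ::
  "('o, 'a) cat \<Rightarrow> ('s, 't) ring_scheme \<Rightarrow> ('o, 'a, 's, 'm) mod_functor \<Rightarrow> ('o \<Rightarrow> 'm \<Rightarrow> 'm) ring"
  where "end_ring C S F =
    \<lparr>carrier = nat_trans C S F F,
     monoid.mult = nt_comp C F,
     one = nt_id C F,
     ring.zero = (\<lambda>x\<in>Ob C. \<lambda>m\<in>carrier (fob F x). \<zero>\<^bsub>fob F x\<^esub>),
     ring.add = (\<lambda>\<eta> \<theta>. \<lambda>x\<in>Ob C. \<lambda>m\<in>carrier (fob F x). \<eta> x m \<oplus>\<^bsub>fob F x\<^esub> \<theta> x m)\<rparr>"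

definition strongly_indecomposable ::
  "('o, 'a) cat \<Rightarrow> ('s, 't) ring_scheme \<Rightarrow> ('o, 'a, 's, 'm) mod_functor \<Rightarrow> bool"
  where "strongly_indecomposable C S F \<longleftrightarrow> module_functor C S F \<and> local_ring (end_ring C S F)"

text \<open>Direct sums, that is, coproducts, in the functor category are computed objectwise.
  An index type for decompositions of a functor with values in \<open>'m\<close> into strongly indecomposable
  functors is \<open>'o \<Rightarrow> 'm set\<close>: the summands are nonzero, so they are pairwise distinct as subfunctors
  and may be indexed by the carriers of these.\<close>

definition functor_direct_sum ::
  "'i set \<Rightarrow> ('i \<Rightarrow> ('o, 'a, 's, 'm) mod_functor) \<Rightarrow> ('o, 'a, 's, 'i \<Rightarrow> 'm) mod_functor"
  where "functor_direct_sum I G =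
    \<lparr>fob = (\<lambda>x. module_direct_sum I (\<lambda>i. fob (G i) x)),
     far = (\<lambda>f v. \<lambda>i\<in>I. far (G i) f (v i))\<rparr>"


section \<open>Endomorphism rings are rings and direct sums are functors\<close>

lemma mod_homD:
  assumes "h \<in> mod_hom S M N"
  shows "m \<in> carrier M \<Longrightarrow> h m \<in> carrier N"
    and "\<lbrakk>m \<in> carrier M; n \<in> carrier M\<rbrakk> \<Longrightarrow> h (m \<oplus>\<^bsub>M\<^esub> n) = h m \<oplus>\<^bsub>N\<^esub> h n"
    and "\<lbrakk>a \<in> carrier S; m \<in> carrier M\<rbrakk> \<Longrightarrow> h (a \<odot>\<^bsub>M\<^esub> m) = a \<odot>\<^bsub>N\<^esub> h m"
  using assms by (auto simp: mod_hom_def hom_def)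

lemma mod_homI:
  assumes "\<And>m. m \<in> carrier M \<Longrightarrow> h m \<in> carrier N"
    and "\<And>m n. \<lbrakk>m \<in> carrier M; n \<in> carrier M\<rbrakk> \<Longrightarrow> h (m \<oplus>\<^bsub>M\<^esub> n) = h m \<oplus>\<^bsub>N\<^esub> h n"
    and "\<And>a m. \<lbrakk>a \<in> carrier S; m \<in> carrier M\<rbrakk> \<Longrightarrow> h (a \<odot>\<^bsub>M\<^esub> m) = a \<odot>\<^bsub>N\<^esub> h m"
  shows "h \<in> mod_hom S M N"
  using assms by (auto simp: mod_hom_def hom_def)

lemma mod_hom_zero:
  assumes "module S M" "module S N" "h \<in> mod_hom S M N"
  shows "h \<zero>\<^bsub>M\<^esub> = \<zero>\<^bsub>N\<^esub>"
proof -
  interpret M: module S M by fact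
  interpret N: module S N by fact
  have "h \<zero>\<^bsub>M\<^esub> \<oplus>\<^bsub>N\<^esub> h \<zero>\<^bsub>M\<^esub> = h \<zero>\<^bsub>M\<^esub>" "h \<zero>\<^bsub>M\<^esub> \<in> carrier N"
    using mod_homD(1)[OF assms(3), of "\<zero>\<^bsub>M\<^esub>"] mod_homD(2)[OF assms(3), of "\<zero>\<^bsub>M\<^esub>" "\<zero>\<^bsub>M\<^esub>"] by auto
  then show ?thesis by (metis N.M.add.l_cancel_one N.M.add.one_closed)
qed

lemma module_direct_sum_module:
  assumes "cring S" and M: "\<And>i. i \<in> I \<Longrightarrow> module S (M i)"
  shows "module S (module_direct_sum I M)"
proof -
  interpret S: cring S by fact
  let ?D = "module_direct_sum I M"
  note ag = module.axioms(2)[OF M]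
  note am = abelian_group.axioms(1)[OF ag]
  have z: "\<zero>\<^bsub>?D\<^esub> \<in> carrier ?D"
    using am by (auto simp: module_direct_sum_def abelian_monoid.zero_closed)
  have plus: "v \<oplus>\<^bsub>?D\<^esub> w \<in> carrier ?D" if "v \<in> carrier ?D" "w \<in> carrier ?D" for v w
  proof -
    have "{i \<in> I. v i \<oplus>\<^bsub>M i\<^esub> w i \<noteq> \<zero>\<^bsub>M i\<^esub>} \<subseteq> {i \<in> I. v i \<noteq> \<zero>\<^bsub>M i\<^esub>} \<union> {i \<in> I. w i \<noteq> \<zero>\<^bsub>M i\<^esub>}"
      using am by (auto simp: abelian_monoid.l_zero abelian_monoid.zero_closed)
    then have "finite {i \<in> I. v i \<oplus>\<^bsub>M i\<^esub> w i \<noteq> \<zero>\<^bsub>M i\<^esub>}"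
      using that by (auto simp: module_direct_sum_def intro: finite_subset)
    then show ?thesis using that am
      by (auto simp: module_direct_sum_def PiE_iff abelian_monoid.a_closed
          cong: conj_cong)
  qed
  have neg: "\<exists>w\<in>carrier ?D. w \<oplus>\<^bsub>?D\<^esub> v = \<zero>\<^bsub>?D\<^esub>" if "v \<in> carrier ?D" for v
  proof
    let ?w = "\<lambda>i\<in>I. \<ominus>\<^bsub>M i\<^esub> v i"
    show "?w \<oplus>\<^bsub>?D\<^esub> v = \<zero>\<^bsub>?D\<^esub>"
      using that ag by (auto simp: module_direct_sum_def PiE_iff abelian_group.l_neg intro!: ext)
    have "{i \<in> I. \<ominus>\<^bsub>M i\<^esub> v i \<noteq> \<zero>\<^bsub>M i\<^esub>} \<subseteq> {i \<in> I. v i \<noteq> \<zero>\<^bsub>M i\<^esub>}"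
      using monoid.inv_one[OF group.is_monoid[OF comm_group.axioms(2)[OF abelian_group.a_comm_group[OF ag]]]] by (auto simp: a_inv_def)
    then have "finite {i \<in> I. \<ominus>\<^bsub>M i\<^esub> v i \<noteq> \<zero>\<^bsub>M i\<^esub>}"
      using that by (auto simp: module_direct_sum_def intro: finite_subset)
    then show "?w \<in> carrier ?D" using that ag
      by (auto simp: module_direct_sum_def PiE_iff abelian_group.a_inv_closed cong: conj_cong)
  qed
  have sm: "a \<odot>\<^bsub>?D\<^esub> v \<in> carrier ?D" if "a \<in> carrier S" "v \<in> carrier ?D" for a v
  proof -
    have "{i \<in> I. a \<odot>\<^bsub>M i\<^esub> v i \<noteq> \<zero>\<^bsub>M i\<^esub>} \<subseteq> {i \<in> I. v i \<noteq> \<zero>\<^bsub>M i\<^esub>}"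
      using module.smult_r_null[OF M] that by auto
    then have "finite {i \<in> I. a \<odot>\<^bsub>M i\<^esub> v i \<noteq> \<zero>\<^bsub>M i\<^esub>}"
      using that by (auto simp: module_direct_sum_def intro: finite_subset)
    then show ?thesis using that M
      by (auto simp: module_direct_sum_def PiE_iff module.smult_closed[OF M] cong: conj_cong)
  qed
  have "abelian_group ?D"
  proof (rule abelian_groupI)
    fix u v w assume "u \<in> carrier ?D" "v \<in> carrier ?D" "w \<in> carrier ?D"
    then show "u \<oplus>\<^bsub>?D\<^esub> v \<oplus>\<^bsub>?D\<^esub> w = u \<oplus>\<^bsub>?D\<^esub> (v \<oplus>\<^bsub>?D\<^esub> w)"
      using am by (auto simp: module_direct_sum_def PiE_iff abelian_monoid.a_assoc intro!: ext)
  next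
    fix u v assume "u \<in> carrier ?D" "v \<in> carrier ?D"
    then show "u \<oplus>\<^bsub>?D\<^esub> v = v \<oplus>\<^bsub>?D\<^esub> u"
      using am by (auto simp: module_direct_sum_def PiE_iff abelian_monoid.a_comm intro!: ext)
  next
    fix u assume "u \<in> carrier ?D"
    then show "\<zero>\<^bsub>?D\<^esub> \<oplus>\<^bsub>?D\<^esub> u = u"
      using am by (auto simp: module_direct_sum_def PiE_iff abelian_monoid.l_zero restrict_def extensional_def intro!: ext)
  qed (use z plus neg in auto)
  then show ?thesis
  proof (intro moduleI sm)
    fix u assume "u \<in> carrier ?D"
    then show "\<one>\<^bsub>S\<^esub> \<odot>\<^bsub>?D\<^esub> u = u"
      using M by (auto simp: module_direct_sum_def PiE_iff module.smult_one[OF M] restrict_def extensional_def intro!: ext)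
  qed (use M assms in \<open>auto simp: module_direct_sum_def PiE_iff module.smult_assoc1[OF M]
       module.smult_l_distr[OF M] module.smult_r_distr[OF M] S.ring_simprules intro!: ext\<close>)
qed

lemma functor_direct_sum_module_functor:
  assumes "small_category C" "cring S" and G: "\<And>i. i \<in> I \<Longrightarrow> module_functor C S (G i)"
  shows "module_functor C S (functor_direct_sum I G)"
proof -
  interpret small_category C by fact
  interpret S: cring S by fact
  note Gob = module_functor.fob_module[OF G]
  note Ghom = module_functor.far_hom[OF G]
  show ?thesis
  proof (intro module_functor.intro module_functor_axioms.intro)
    fix x assume "x \<in> Ob C"
    then show "module S (fob (functor_direct_sum I G) x)"
      using Gob S.cring_axioms
      by (auto simp: functor_direct_sum_def intro!: module_direct_sum_module)
  next
    fix f assume f: "f \<in> Ar C"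
    let ?D = "\<lambda>x. module_direct_sum I (\<lambda>i. fob (G i) x)"
    show "far (functor_direct_sum I G) f
      \<in> mod_hom S (fob (functor_direct_sum I G) (Dom C f)) (fob (functor_direct_sum I G) (Cod C f))"
    proof (rule mod_homI)
      fix v assume v: "v \<in> carrier (fob (functor_direct_sum I G) (Dom C f))"
      have "{i \<in> I. far (G i) f (v i) \<noteq> \<zero>\<^bsub>fob (G i) (Cod C f)\<^esub>} \<subseteq> {i \<in> I. v i \<noteq> \<zero>\<^bsub>fob (G i) (Dom C f)\<^esub>}"
        using mod_hom_zero[OF Gob Gob Ghom] f Dom_closed Cod_closed by fastforce
      then have "finite {i \<in> I. far (G i) f (v i) \<noteq> \<zero>\<^bsub>fob (G i) (Cod C f)\<^esub>}"
        using v by (auto simp: module_direct_sum_def functor_direct_sum_def intro: finite_subset)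
      then show "far (functor_direct_sum I G) f v \<in> carrier (fob (functor_direct_sum I G) (Cod C f))"
        using v mod_homD(1)[OF Ghom] f 
        by (auto simp: module_direct_sum_def functor_direct_sum_def PiE_iff cong: conj_cong)
    qed (use mod_homD[OF Ghom] f module.smult_closed[OF Gob] abelian_monoid.a_closed[OF abelian_group.axioms(1)[OF module.axioms(2)[OF Gob]]] in
       \<open>auto simp: module_direct_sum_def functor_direct_sum_def PiE_iff intro!: ext\<close>)
  next
    fix x v assume "x \<in> Ob C" "v \<in> carrier (fob (functor_direct_sum I G) x)"
    then show "far (functor_direct_sum I G) (Idn C x) v = v"
      using module_functor.far_Idn[OF G]
      by (auto simp: module_direct_sum_def functor_direct_sum_def PiE_iff restrict_def extensional_def intro!: ext)
  next
    fix f g v assume "f \<in> Ar C" "g \<in> Ar C" "Cod C f = Dom C g"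
      "v \<in> carrier (fob (functor_direct_sum I G) (Dom C f))"
    then show "far (functor_direct_sum I G) (Cmp C g f) v =
        far (functor_direct_sum I G) g (far (functor_direct_sum I G) f v)"
      using module_functor.far_Cmp[OF G]
      by (auto simp: module_direct_sum_def functor_direct_sum_def PiE_iff intro!: ext)
  qed (fact assms)+
qed

lemma nat_transD:
  assumes "\<eta> \<in> nat_trans C S F G"
  shows "x \<in> Ob C \<Longrightarrow> \<eta> x \<in> mod_hom S (fob F x) (fob G x)"
    and "\<lbrakk>x \<in> Ob C; m \<notin> carrier (fob F x)\<rbrakk> \<Longrightarrow> \<eta> x m = undefined"
    and "x \<notin> Ob C \<Longrightarrow> \<eta> x = undefined"
    and "\<lbrakk>f \<in> Ar C; m \<in> carrier (fob F (Dom C f))\<rbrakk> \<Longrightarrow>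
         \<eta> (Cod C f) (far F f m) = far G f (\<eta> (Dom C f) m)"
  using assms by (auto simp: nat_trans_def PiE_iff extensional_def)

lemma nat_trans_eqI:
  assumes "\<eta> \<in> nat_trans C S F G" "\<theta> \<in> nat_trans C S F G"
    and "\<And>x m. \<lbrakk>x \<in> Ob C; m \<in> carrier (fob F x)\<rbrakk> \<Longrightarrow> \<eta> x m = \<theta> x m"
  shows "\<eta> = \<theta>"
proof (intro ext)
  fix x m show "\<eta> x m = \<theta> x m"
    using assms(3) nat_transD(2,3)[OF assms(1)] nat_transD(2,3)[OF assms(2)] by metis
qed

lemma nat_transI:
  assumes "small_category C"
    and F: "module_functor C S F"
    and "\<And>x. x \<in> Ob C \<Longrightarrow> h x \<in> mod_hom S (fob F x) (fob G x)"
    and "\<And>f m. \<lbrakk>f \<in> Ar C; m \<in> carrier (fob F (Dom C f))\<rbrakk> \<Longrightarrow>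
         h (Cod C f) (far F f m) = far G f (h (Dom C f) m)"
  shows "(\<lambda>x\<in>Ob C. \<lambda>m\<in>carrier (fob F x). h x m) \<in> nat_trans C S F G"
proof -
  interpret small_category C by fact
  note far = mod_homD(1)[OF module_functor.far_hom[OF F]]
  have mod: "\<And>x. x \<in> Ob C \<Longrightarrow> module S (fob F x)" using module_functor.fob_module[OF F] .
  have "(\<lambda>m\<in>carrier (fob F x). h x m) \<in> mod_hom S (fob F x) (fob G x)" if "x \<in> Ob C" for x
  proof -
    interpret module S "fob F x" using mod that .
    show ?thesis by (rule mod_homI) (auto simp: mod_homD[OF assms(3)[OF that]])
  qed
  then show ?thesis using assms(4) far Dom_closed Cod_closed
    by (auto simp: nat_trans_def)
qed

lemma end_ring_ring:
  assumes "module_functor C S F"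
  shows "ring (end_ring C S F)"
proof -
  interpret F: module_functor C S F by fact
  let ?E = "end_ring C S F"
  have mod: "\<And>x. x \<in> Ob C \<Longrightarrow> module S (fob F x)" using F.fob_module .
  note D = nat_transD(1)[THEN mod_homD(1)] nat_transD(1)[THEN mod_homD(2)] nat_transD(1)[THEN mod_homD(3)]
  note ag = module.axioms(2)[OF mod]
  note am = abelian_group.axioms(1)[OF ag]
  note nI = nat_transI[OF F.small_category_axioms assms]
  note fh = mod_homD[OF F.far_hom]
  note simps = D am abelian_monoid.a_closed abelian_monoid.zero_closed abelian_monoid.l_zero
      abelian_group.l_neg abelian_group.a_inv_closed
      F.Dom_closed F.Cod_closed fh nat_transD(4) mod
  have E: "carrier ?E = nat_trans C S F F" by (simp add: end_ring_def)
  have one: "\<one>\<^bsub>?E\<^esub> \<in> nat_trans C S F F"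
    by (auto simp: end_ring_def nt_id_def intro!: nI mod_homI)
  have zero: "\<zero>\<^bsub>?E\<^esub> \<in> nat_trans C S F F"
    by (auto simp: end_ring_def simps module.smult_r_null[OF mod] mod_hom_zero[OF mod mod F.far_hom] intro!: nI mod_homI)
  have add: "\<eta> \<oplus>\<^bsub>?E\<^esub> \<theta> \<in> nat_trans C S F F"
    if "\<eta> \<in> nat_trans C S F F" "\<theta> \<in> nat_trans C S F F" for \<eta> \<theta>
    unfolding end_ring_def using that
    by (auto simp: simps module.smult_r_distr[OF mod] module.smult_closed[OF mod] abelian_monoid.a_ac intro!: nI mod_homI)
  have mult: "\<eta> \<otimes>\<^bsub>?E\<^esub> \<theta> \<in> nat_trans C S F F"
    if "\<eta> \<in> nat_trans C S F F" "\<theta> \<in> nat_trans C S F F" for \<eta> \<theta>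
    unfolding end_ring_def using that
    by (auto simp: simps nt_comp_def compose_def module.smult_closed[OF mod] intro!: nI mod_homI)
  have neg: "\<exists>\<theta>\<in>nat_trans C S F F. \<theta> \<oplus>\<^bsub>?E\<^esub> \<eta> = \<zero>\<^bsub>?E\<^esub>" if h: "\<eta> \<in> nat_trans C S F F" for \<eta>
  proof
    let ?t = "\<lambda>x\<in>Ob C. \<lambda>m\<in>carrier (fob F x). \<ominus>\<^bsub>fob F x\<^esub> \<eta> x m"
    have inv: "far F f (\<ominus>\<^bsub>fob F (Dom C f)\<^esub> m) = \<ominus>\<^bsub>fob F (Cod C f)\<^esub> far F f m"
      if "f \<in> Ar C" "m \<in> carrier (fob F (Dom C f))" for f m
    proof -
      interpret c: abelian_group "fob F (Cod C f)" using ag F.Cod_closed that by blast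
      interpret d: abelian_group "fob F (Dom C f)" using ag F.Dom_closed that by blast
      have "far F f (\<ominus>\<^bsub>fob F (Dom C f)\<^esub> m) \<oplus>\<^bsub>fob F (Cod C f)\<^esub> far F f m = \<zero>\<^bsub>fob F (Cod C f)\<^esub>"
        using that fh(2)[of f "\<ominus>\<^bsub>fob F (Dom C f)\<^esub> m" m]
         mod_hom_zero[OF mod mod F.far_hom] F.Dom_closed F.Cod_closed by (simp add: d.l_neg)
      then show ?thesis using that fh(1) d.a_inv_closed c.minus_equality by metis
    qed
    show "?t \<in> nat_trans C S F F"
      using h by (auto simp: simps inv module.smult_r_minus[OF mod] module.smult_closed[OF mod] abelian_group.minus_add[OF ag] abelian_group.a_inv_closed[OF ag] intro!: nI mod_homI)
    show "?t \<oplus>\<^bsub>?E\<^esub> \<eta> = \<zero>\<^bsub>?E\<^esub>"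
      using h by (auto simp: end_ring_def simps abelian_group.l_neg[OF ag] intro!: ext)
  qed
  show ?thesis
  proof (intro ringI abelian_groupI monoidI; unfold E)
    fix a b c assume abc: "a \<in> nat_trans C S F F" "b \<in> nat_trans C S F F" "c \<in> nat_trans C S F F"
    show "a \<oplus>\<^bsub>?E\<^esub> b \<oplus>\<^bsub>?E\<^esub> c = a \<oplus>\<^bsub>?E\<^esub> (b \<oplus>\<^bsub>?E\<^esub> c)"
      "a \<otimes>\<^bsub>?E\<^esub> b \<otimes>\<^bsub>?E\<^esub> c = a \<otimes>\<^bsub>?E\<^esub> (b \<otimes>\<^bsub>?E\<^esub> c)"
      "(a \<oplus>\<^bsub>?E\<^esub> b) \<otimes>\<^bsub>?E\<^esub> c = a \<otimes>\<^bsub>?E\<^esub> c \<oplus>\<^bsub>?E\<^esub> b \<otimes>\<^bsub>?E\<^esub> c"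
      "c \<otimes>\<^bsub>?E\<^esub> (a \<oplus>\<^bsub>?E\<^esub> b) = c \<otimes>\<^bsub>?E\<^esub> a \<oplus>\<^bsub>?E\<^esub> c \<otimes>\<^bsub>?E\<^esub> b"
      using abc by (auto simp: end_ring_def nt_comp_def compose_def simps abelian_monoid.a_assoc intro!: ext)
  next
    fix a b assume "a \<in> nat_trans C S F F" "b \<in> nat_trans C S F F"
    then show "a \<oplus>\<^bsub>?E\<^esub> b = b \<oplus>\<^bsub>?E\<^esub> a"
      by (auto simp: end_ring_def simps abelian_monoid.a_comm intro!: ext)
  next
    fix a assume a: "a \<in> nat_trans C S F F"
    show "\<zero>\<^bsub>?E\<^esub> \<oplus>\<^bsub>?E\<^esub> a = a" 
      by (rule nat_trans_eqI[OF add[OF zero a] a]) (use a in \<open>auto simp: end_ring_def simps\<close>)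
    show "\<one>\<^bsub>?E\<^esub> \<otimes>\<^bsub>?E\<^esub> a = a"
      by (rule nat_trans_eqI[OF mult[OF one a] a]) (use a in \<open>auto simp: end_ring_def nt_comp_def nt_id_def compose_def simps\<close>)
    show "a \<otimes>\<^bsub>?E\<^esub> \<one>\<^bsub>?E\<^esub> = a"
      by (rule nat_trans_eqI[OF mult[OF a one] a]) (use a in \<open>auto simp: end_ring_def nt_comp_def nt_id_def compose_def simps\<close>)
  qed (use one zero add mult neg in auto)
qed

end

(*
  For a maximal set B of commuting idempotent natural endomorphisms of F, the descending chain
  condition makes the image of B in End (F x) a finite Boolean algebra for every object x. A
  downward directed subset of B is therefore objectwise eventually constant; its objectwise limit is
  natural and by maximality belongs to B. This yields enough atoms: at every object the identity is
  a finite sum of atoms, so that F is the direct sum of the images a F of the atoms a.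

  For an endomorphism t of G = a F and an element m, the submodules t^k P m, where P is the
  bicommutant of t, form a descending chain, because S is commutative. Hence G is the direct sum of
  the part on which t is locally nilpotent and a part on which t is bijective. As a is an atom, one
  of them is zero, so t or 1 - t is invertible.
*)

theory Submission
  imports Defs
begin

section \<open>Modules and natural transformations\<close>

text \<open>The chain condition acts at one object at a time. With infinitely many objects a functor
  can split without end, so repeated splitting need not stop; all summands are therefore sought
  inside one algebra \<open>B\<close> fixed beforehand. Maximality of \<open>B\<close> works twice:
  it returns objectwise limits to \<open>B\<close>, and it catches every idempotent that would split
  the image of an atom. The Fitting argument has to cope with modules that are artinian but of
  infinite length. The exponent at which a chain stops depends on \<open>m\<close>, and the common
  image of all powers is no complement to the locally nilpotent part: multiplication by p on the
  Pruefer p-group is both surjective and locally nilpotent. The second summand thus consists of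
  those \<open>m\<close> with \<open>t q m = m\<close> for some \<open>q\<close> in
  \<open>P\<close>; as \<open>q\<close> commutes with \<open>t\<close>, this rules out nilpotence at
  nonzero \<open>m\<close>. Any commutative ring of endomorphisms containing \<open>t\<close> and
  the scalars could take the role of \<open>P\<close>; the bicommutant inherits its closure
  properties from commutants in general.\<close>

lemma (in abelian_group) minus_zero_right: "x \<in> carrier G \<Longrightarrow> x \<ominus> \<zero> = x"
  by (simp add: a_minus_def)

lemma (in abelian_group) minus_self: "x \<in> carrier G \<Longrightarrow> x \<ominus> x = \<zero>"
  by (simp add: a_minus_def r_neg)

lemma (in abelian_group) right_minus_eqD:
  assumes "x \<ominus> y = \<zero>" "x \<in> carrier G" "y \<in> carrier G"
  shows "x = y"
  using assms minus_equality[of x "\<ominus> y"] by (simp add: a_minus_def minus_minus)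

text \<open>The chain condition as well-foundedness, for choosing minimal images in
  \<open>minimal_image\<close> and for the induction in \<open>atomic_sum\<close>.\<close>

lemma artinian_module_wf:
  assumes "artinian_module S M"
  shows "wf {(N, N'). submodule N S M \<and> submodule N' S M \<and> N \<subset> N'}"
  unfolding wf_iff_no_infinite_down_chain
proof (intro notI, elim exE)
  fix N assume N: "\<forall>k. (N (Suc k), N k) \<in> {(N, N'). submodule N S M \<and> submodule N' S M \<and> N \<subset> N'}"
  then have "\<And>k. submodule (N k) S M" "\<And>k. N (Suc k) \<subseteq> N k" by auto
  then have "\<exists>n. \<forall>k\<ge>n. N k = N n"
    using assms by (simp add: artinian_module_def)
  then obtain n where "\<forall>k\<ge>n. N k = N n" ..
  then have "N (Suc n) = N n" by (rule allE[of _ "Suc n"]) simp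
  then show False using N by auto
qed

text \<open>Carries the hypothesis over to the summands, so that \<open>fitting\<close> can be
  applied to them.\<close>

lemma artinian_submodule:
  assumes "artinian_module S M" "submodule U S M"
  shows "artinian_module S (M\<lparr>carrier := U\<rparr>)"
proof -
  interpret module S M using assms by (simp add: artinian_module_def)
  have U: "module S (M\<lparr>carrier := U\<rparr>)" using submodule.submodule_is_module[OF assms(2) module_axioms] .
  interpret U: module S "M\<lparr>carrier := U\<rparr>" by (fact U)
  have "submodule N S M" if "submodule N S (M\<lparr>carrier := U\<rparr>)" for N
  proof (rule module_incl_imp_submodule)
    show "N \<subseteq> carrier M" using U.submoduleE(1)[OF that] submoduleE(1)[OF assms(2)] by auto
    show "module S (M\<lparr>carrier := N\<rparr>)" using submodule.submodule_is_module[OF that U] by simp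
  qed
  then show ?thesis using assms(1) U by (simp add: artinian_module_def)
qed

lemma mod_hom_minus:
  assumes "module S M" "module S N" "h \<in> mod_hom S M N" "m \<in> carrier M"
  shows "h (\<ominus>\<^bsub>M\<^esub> m) = \<ominus>\<^bsub>N\<^esub> h m"
proof -
  interpret M: module S M by fact
  interpret N: module S N by fact
  have "h (\<ominus>\<^bsub>M\<^esub> m) \<oplus>\<^bsub>N\<^esub> h m = \<zero>\<^bsub>N\<^esub>"
    using assms mod_homD(2)[OF assms(3), of "\<ominus>\<^bsub>M\<^esub> m" m] mod_hom_zero[OF assms(1-3)]
    by (simp add: M.M.l_neg)
  then show ?thesis
    using assms mod_homD(1)[OF assms(3)] by (metis M.M.a_inv_closed N.M.minus_equality)
qed

lemma mod_hom_diff: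
  assumes "module S M" "module S N" "h \<in> mod_hom S M N" "m \<in> carrier M" "n \<in> carrier M"
  shows "h (m \<ominus>\<^bsub>M\<^esub> n) = h m \<ominus>\<^bsub>N\<^esub> h n"
proof -
  interpret M: module S M by fact
  show ?thesis
    using assms mod_homD(2)[OF assms(3)] mod_hom_minus[OF assms(1-3)] by (simp add: a_minus_def)
qed

lemma mod_hom_image_submodule:
  assumes "module S M" "module S N" "h \<in> mod_hom S M N"
  shows "submodule (h ` carrier M) S N"
proof -
  interpret M: module S M by fact
  interpret N: module S N by fact
  note h = mod_homD[OF assms(3)]
  show ?thesis
  proof (rule N.submoduleI)
    show "\<zero>\<^bsub>N\<^esub> \<in> h ` carrier M" using mod_hom_zero[OF assms] by (metis M.M.zero_closed image_eqI)
    fix a assume "a \<in> h ` carrier M"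
    then show "\<ominus>\<^bsub>N\<^esub> a \<in> h ` carrier M" 
      using mod_hom_minus[OF assms] by (metis (no_types, lifting) M.M.a_inv_closed image_iff)
  next
    fix a b assume "a \<in> h ` carrier M" "b \<in> h ` carrier M"
    then show "a \<oplus>\<^bsub>N\<^esub> b \<in> h ` carrier M"
      using h(2) by (auto simp flip: h(2))
  next
    fix a b assume "a \<in> carrier S" "b \<in> h ` carrier M"
    then show "a \<odot>\<^bsub>N\<^esub> b \<in> h ` carrier M"
      by (auto simp flip: h(3))
  qed (use h(1) in auto)
qed

text \<open>The inverse maps are linear and natural because a preimage is determined by its value,
  which is what \<open>eq\<close> expresses. This serves both for units of the endomorphism ring and
  for the final isomorphism.\<close>

lemma nat_trans_inverse:
  assumes F: "module_functor C S F" and G: "module_functor C S G"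
    and \<eta>: "\<eta> \<in> nat_trans C S F G"
    and bij: "\<And>x. x \<in> Ob C \<Longrightarrow> bij_betw (\<eta> x) (carrier (fob F x)) (carrier (fob G x))"
  shows "\<exists>\<theta>\<in>nat_trans C S G F. nt_comp C F \<theta> \<eta> = nt_id C F \<and> nt_comp C G \<eta> \<theta> = nt_id C G"
proof -
  interpret F: module_functor C S F by fact
  interpret G: module_functor C S G by fact
  define h where "h x = inv_into (carrier (fob F x)) (\<eta> x)" for x
  define \<theta> where "\<theta> = (\<lambda>x\<in>Ob C. \<lambda>n\<in>carrier (fob G x). h x n)"
  have h: "h x n \<in> carrier (fob F x)" "\<eta> x (h x n) = n"
    if "x \<in> Ob C" "n \<in> carrier (fob G x)" for x n
    using bij[OF that(1)] that(2) unfolding h_def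
    by (auto simp: bij_betw_def inv_into_into f_inv_into_f)
  have h': "h x (\<eta> x m) = m" if "x \<in> Ob C" "m \<in> carrier (fob F x)" for x m
    using bij[OF that(1)] that(2) unfolding h_def by (auto simp: bij_betw_def)
  note \<eta>' = mod_homD[OF nat_transD(1)[OF \<eta>]]
  have eq: "h x n = m" if "x \<in> Ob C" "m \<in> carrier (fob F x)" "\<eta> x m = n" for x n m
    using h' that by auto
  have "\<theta> \<in> nat_trans C S G F" unfolding \<theta>_def
  proof (rule nat_transI[OF F.small_category_axioms G])
    fix x assume x: "x \<in> Ob C"
    interpret M: module S "fob F x" using F.fob_module[OF x] .
    show "h x \<in> mod_hom S (fob G x) (fob F x)"
      by (rule mod_homI; (rule eq)?) (use x h \<eta>' in auto)
  next
    fix f n assume f: "f \<in> Ar C" "n \<in> carrier (fob G (Dom C f))"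
    then show "h (Cod C f) (far G f n) = far F f (h (Dom C f) n)"
      by (intro eq) (auto simp: F.Dom_closed F.Cod_closed h nat_transD(4)[OF \<eta>] 
          intro: mod_homD(1)[OF F.far_hom])
  qed
  moreover have "nt_comp C F \<theta> \<eta> = nt_id C F" "nt_comp C G \<eta> \<theta> = nt_id C G"
    by (auto simp: nt_comp_def nt_id_def compose_def \<theta>_def h h' \<eta>' intro!: ext)
  ultimately show ?thesis by blast
qed

section \<open>Endomorphisms\<close>

sublocale module_functor \<subseteq> E: ring "end_ring C S F"
  by (rule end_ring_ring) (fact module_functor_axioms)

context module_functor
begin

abbreviation "E \<equiv> end_ring C S F"

abbreviation "M \<equiv> fob F"

lemma abelian_group_fob: "x \<in> Ob C \<Longrightarrow> abelian_group (M x)"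
  using fob_module by (rule module.axioms(2))

lemma far_closed:
  assumes "f \<in> Ar C" "m \<in> carrier (M (Dom C f))"
  shows "far F f m \<in> carrier (M (Cod C f))"
  using far_hom[OF assms(1)] assms(2) by (rule mod_homD)

lemma carrier_E: "carrier E = nat_trans C S F F"
  by (simp add: end_ring_def)

lemma E_mod_hom: "\<lbrakk>p \<in> carrier E; x \<in> Ob C\<rbrakk> \<Longrightarrow> p x \<in> mod_hom S (M x) (M x)"
  unfolding carrier_E by (rule nat_transD)

lemma E_closed: "\<lbrakk>p \<in> carrier E; x \<in> Ob C; m \<in> carrier (M x)\<rbrakk> \<Longrightarrow> p x m \<in> carrier (M x)"
  by (rule mod_homD(1)[OF E_mod_hom])

lemma E_eqI:
  assumes "p \<in> carrier E" "q \<in> carrier E"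
    and "\<And>x m. \<lbrakk>x \<in> Ob C; m \<in> carrier (M x)\<rbrakk> \<Longrightarrow> p x m = q x m"
  shows "p = q"
  using assms unfolding carrier_E by (rule nat_trans_eqI)

lemma E_mult: "\<lbrakk>x \<in> Ob C; m \<in> carrier (M x)\<rbrakk> \<Longrightarrow> (p \<otimes>\<^bsub>E\<^esub> q) x m = p x (q x m)"
  by (simp add: end_ring_def nt_comp_def compose_def)

lemma E_one: "\<lbrakk>x \<in> Ob C; m \<in> carrier (M x)\<rbrakk> \<Longrightarrow> \<one>\<^bsub>E\<^esub> x m = m"
  by (simp add: end_ring_def nt_id_def)

lemma E_zero: "\<lbrakk>x \<in> Ob C; m \<in> carrier (M x)\<rbrakk> \<Longrightarrow> \<zero>\<^bsub>E\<^esub> x m = \<zero>\<^bsub>M x\<^esub>"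
  by (simp add: end_ring_def)

lemma E_add: "\<lbrakk>x \<in> Ob C; m \<in> carrier (M x)\<rbrakk> \<Longrightarrow> (p \<oplus>\<^bsub>E\<^esub> q) x m = p x m \<oplus>\<^bsub>M x\<^esub> q x m"
  by (simp add: end_ring_def)

lemma E_minus:
  assumes "p \<in> carrier E" "x \<in> Ob C" "m \<in> carrier (M x)"
  shows "(\<ominus>\<^bsub>E\<^esub> p) x m = \<ominus>\<^bsub>M x\<^esub> p x m"
proof -
  interpret Mx: abelian_group "M x" using assms abelian_group_fob by blast
  have "(\<ominus>\<^bsub>E\<^esub> p) x m \<oplus>\<^bsub>M x\<^esub> p x m = \<zero>\<^bsub>M x\<^esub>"
    using assms by (simp add: E.l_neg E_zero flip: E_add)
  then show ?thesis
    using assms by (metis E.a_inv_closed E_closed Mx.minus_equality)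
qed

lemma E_diff:
  "\<lbrakk>p \<in> carrier E; q \<in> carrier E; x \<in> Ob C; m \<in> carrier (M x)\<rbrakk>
    \<Longrightarrow> (p \<ominus>\<^bsub>E\<^esub> q) x m = p x m \<ominus>\<^bsub>M x\<^esub> q x m"
  by (simp add: a_minus_def E_add E_minus)

lemmas E_simps = E_mult E_one E_zero E_add E_minus E_diff

lemma E_natural:
  assumes "p \<in> carrier E" "f \<in> Ar C" "m \<in> carrier (M (Dom C f))"
  shows "p (Cod C f) (far F f m) = far F f (p (Dom C f) m)"
  using assms unfolding carrier_E by (intro nat_transD(4))

lemma E_apply_add:
  "\<lbrakk>p \<in> carrier E; x \<in> Ob C; m \<in> carrier (M x); n \<in> carrier (M x)\<rbrakk>
    \<Longrightarrow> p x (m \<oplus>\<^bsub>M x\<^esub> n) = p x m \<oplus>\<^bsub>M x\<^esub> p x n"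
  by (rule mod_homD(2)[OF E_mod_hom])

lemma E_apply_smult:
  "\<lbrakk>p \<in> carrier E; x \<in> Ob C; a \<in> carrier S; m \<in> carrier (M x)\<rbrakk>
    \<Longrightarrow> p x (a \<odot>\<^bsub>M x\<^esub> m) = a \<odot>\<^bsub>M x\<^esub> p x m"
  by (rule mod_homD(3)[OF E_mod_hom])

lemma E_apply_zero: "\<lbrakk>p \<in> carrier E; x \<in> Ob C\<rbrakk> \<Longrightarrow> p x \<zero>\<^bsub>M x\<^esub> = \<zero>\<^bsub>M x\<^esub>"
  by (intro mod_hom_zero[OF _ _ E_mod_hom] fob_module)

lemma E_apply_minus:
  "\<lbrakk>p \<in> carrier E; x \<in> Ob C; m \<in> carrier (M x)\<rbrakk> \<Longrightarrow> p x (\<ominus>\<^bsub>M x\<^esub> m) = \<ominus>\<^bsub>M x\<^esub> p x m"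
  by (intro mod_hom_minus[OF _ _ E_mod_hom] fob_module)

lemma E_apply_diff:
  "\<lbrakk>p \<in> carrier E; x \<in> Ob C; m \<in> carrier (M x); n \<in> carrier (M x)\<rbrakk>
    \<Longrightarrow> p x (m \<ominus>\<^bsub>M x\<^esub> n) = p x m \<ominus>\<^bsub>M x\<^esub> p x n"
  by (intro mod_hom_diff[OF _ _ E_mod_hom] fob_module)

lemmas E_apply = E_apply_add E_apply_smult E_apply_zero E_apply_minus E_apply_diff

lemma E_Units:
  assumes "p \<in> carrier E"
    and "\<And>x. x \<in> Ob C \<Longrightarrow> bij_betw (p x) (carrier (M x)) (carrier (M x))"
  shows "p \<in> Units E"
  using nat_trans_inverse[OF module_functor_axioms module_functor_axioms _ assms(2)] assms(1)
  unfolding Units_def by (auto simp: end_ring_def)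

lemma submodule_image: "\<lbrakk>p \<in> carrier E; x \<in> Ob C\<rbrakk> \<Longrightarrow> submodule (p x ` carrier (M x)) S (M x)"
  by (intro mod_hom_image_submodule[OF _ _ E_mod_hom] fob_module)

lemma E_closedI:
  assumes "\<And>x. x \<in> Ob C \<Longrightarrow> h x \<in> mod_hom S (M x) (M x)"
    and "\<And>f m. \<lbrakk>f \<in> Ar C; m \<in> carrier (M (Dom C f))\<rbrakk> \<Longrightarrow>
         h (Cod C f) (far F f m) = far F f (h (Dom C f) m)"
  shows "(\<lambda>x\<in>Ob C. \<lambda>m\<in>carrier (M x). h x m) \<in> carrier E"
  unfolding carrier_E by (rule nat_transI[OF small_category_axioms module_functor_axioms assms])

end

section \<open>Local rings\<close>

text \<open>Without commutativity, one-sided inverses must first be shown to be two-sided. The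
  hypothesis \<open>local\<close> leaves no idempotents except \<open>\<zero>\<close> and
  \<open>\<one>\<close>, and this applies to \<open>y \<otimes> x\<close> whenever
  \<open>x \<otimes> y = \<one>\<close>.\<close>

lemma (in ring) local_ringI:
  assumes nz: "\<one> \<noteq> \<zero>"
    and local: "\<And>t. t \<in> carrier R \<Longrightarrow> t \<in> Units R \<or> \<one> \<ominus> t \<in> Units R"
  shows "local_ring R"
proof -
  have idem: "e = \<zero> \<or> e = \<one>" if e: "e \<in> carrier R" "e \<otimes> e = e" for e
  proof -
    have *: "u = v" if "w \<in> Units R" "w \<otimes> u = w \<otimes> v" "u \<in> carrier R" "v \<in> carrier R" for u v w
      using that Units_l_cancel by blast
    show ?thesis using local[OF e(1)]
    proof
      assume "e \<in> Units R" then show ?thesis using *[of e e \<one>] e by simp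
    next
      assume "\<one> \<ominus> e \<in> Units R"
      moreover have "(\<one> \<ominus> e) \<otimes> e = \<zero>" using e by (simp add: a_minus_def l_distr l_minus r_neg)
      ultimately show ?thesis using *[of "\<one> \<ominus> e" e \<zero>] e by simp
    qed
  qed
  have unit: "x \<in> Units R \<and> y \<in> Units R"
    if xy: "x \<in> carrier R" "y \<in> carrier R" "x \<otimes> y = \<one>" for x y
  proof -
    have "(y \<otimes> x) \<otimes> (y \<otimes> x) = y \<otimes> (x \<otimes> y) \<otimes> x" using xy(1,2) by (simp add: m_assoc)
    then have "(y \<otimes> x) \<otimes> (y \<otimes> x) = y \<otimes> x" using xy by simp
    then have "y \<otimes> x = \<zero> \<or> y \<otimes> x = \<one>" using idem xy by simp
    moreover have "y \<otimes> x \<noteq> \<zero>"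
    proof
      assume "y \<otimes> x = \<zero>"
      then have "x \<otimes> (y \<otimes> x) \<otimes> y = \<zero>" using xy by simp
      moreover have "x \<otimes> (y \<otimes> x) \<otimes> y = (x \<otimes> y) \<otimes> (x \<otimes> y)" using xy(1,2) by (simp add: m_assoc)
      ultimately show False using xy nz by simp
    qed
    ultimately show ?thesis using xy unfolding Units_def by blast
  qed
  \<comment> \<open>Dividing by the sum gives two elements that add up to \<open>\<one>\<close>,
    where \<open>local\<close> applies. A unit multiple of \<open>x\<close> or \<open>y\<close> then
    yields a left inverse, and \<open>unit\<close> makes it two-sided.\<close>
  have sum: "x \<in> Units R \<or> y \<in> Units R"
    if xy: "x \<in> carrier R" "y \<in> carrier R" "x \<oplus> y \<in> Units R" for x y
  proof -
    let ?u = "inv (x \<oplus> y)"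
    have u: "?u \<in> carrier R" "?u \<otimes> x \<oplus> ?u \<otimes> y = \<one>"
      using xy by (simp_all add: Units_l_inv flip: r_distr)
    then have "\<one> \<ominus> ?u \<otimes> x = ?u \<otimes> y"
      using xy r_neg1[of "?u \<otimes> x" "?u \<otimes> y"] by (simp add: a_minus_def a_comm)
    then have "?u \<otimes> x \<in> Units R \<or> ?u \<otimes> y \<in> Units R" using local[of "?u \<otimes> x"] u(1) xy by auto
    then show ?thesis
    proof
      assume "?u \<otimes> x \<in> Units R"
      then have "inv (?u \<otimes> x) \<otimes> ?u \<otimes> x = \<one>" using u(1) xy Units_l_inv by (simp add: m_assoc)
      then show ?thesis using unit[of "inv (?u \<otimes> x) \<otimes> ?u" x] u xy \<open>?u \<otimes> x \<in> Units R\<close> by simp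
    next
      assume "?u \<otimes> y \<in> Units R"
      then have "inv (?u \<otimes> y) \<otimes> ?u \<otimes> y = \<one>" using u(1) xy Units_l_inv by (simp add: m_assoc)
      then show ?thesis using unit[of "inv (?u \<otimes> y) \<otimes> ?u" y] u xy \<open>?u \<otimes> y \<in> Units R\<close> by simp
    qed
  qed
  have mult: "x \<in> Units R \<and> y \<in> Units R"
    if xy: "x \<in> carrier R" "y \<in> carrier R" "x \<otimes> y \<in> Units R" for x y
  proof -
    let ?u = "inv (x \<otimes> y)"
    have u: "?u \<in> carrier R" "x \<otimes> (y \<otimes> ?u) = \<one>" "?u \<otimes> x \<otimes> y = \<one>"
      using xy(1,2) Units_l_inv[OF xy(3)] Units_r_inv[OF xy(3)] Units_inv_closed[OF xy(3)]
      by (simp_all add: m_assoc)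
    then show ?thesis using unit[of x "y \<otimes> ?u"] unit[of "?u \<otimes> x" y] xy by simp
  qed
  have neg: "x \<in> Units R" if "x \<in> carrier R" "\<ominus> x \<in> Units R" for x
    using mult[of "\<ominus> \<one>" x] that by (simp add: l_minus)
  have "\<zero> \<notin> Units R" using nz Units_r_inv_ex[of \<zero>] by auto
  then have "subgroup (carrier R - Units R) (add_monoid R)"
  proof (intro add.subgroupI)
    show "carrier R - Units R \<noteq> {}" using \<open>\<zero> \<notin> Units R\<close> by blast
    show "\<ominus> x \<in> carrier R - Units R" if "x \<in> carrier R - Units R" for x
      using that neg[of x] by blast
    show "x \<oplus> y \<in> carrier R - Units R"
      if "x \<in> carrier R - Units R" "y \<in> carrier R - Units R" for x y
      using that sum[of x y] by blast
  qed blast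
  then have "ideal (carrier R - Units R) R"
  proof (rule idealI[OF ring_axioms])
    fix a x assume a: "a \<in> carrier R - Units R" and x: "x \<in> carrier R"
    show "x \<otimes> a \<in> carrier R - Units R" using a x mult[of x a] by blast
    show "a \<otimes> x \<in> carrier R - Units R" using a x mult[of a x] by blast
  qed
  then show ?thesis by (simp add: local_ring_def ring_axioms)
qed

section \<open>Fitting decompositions\<close>

definition (in ring) commutant :: "'a set \<Rightarrow> 'a set"
  where "commutant Q = {p \<in> carrier R. \<forall>q\<in>Q. p \<otimes> q = q \<otimes> p}"

context ring
begin

lemma commutant_carrier: "p \<in> commutant Q \<Longrightarrow> p \<in> carrier R"
  by (simp add: commutant_def)

context
  fixes Q assumes Q: "Q \<subseteq> carrier R"
begin

lemma commutant_one: "\<one> \<in> commutant Q"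
  using Q by (auto simp: commutant_def)

lemma commutant_mult:
  assumes "p \<in> commutant Q" "q \<in> commutant Q"
  shows "p \<otimes> q \<in> commutant Q"
proof -
  have "p \<otimes> q \<otimes> r = r \<otimes> (p \<otimes> q)" if "r \<in> Q" for r
  proof -
    have "p \<otimes> q \<otimes> r = p \<otimes> (r \<otimes> q)" using assms that Q by (auto simp: commutant_def m_assoc)
    also have "\<dots> = r \<otimes> p \<otimes> q" using assms that Q by (auto simp: commutant_def simp flip: m_assoc)
    finally show ?thesis using assms that Q by (auto simp: commutant_def m_assoc)
  qed
  then show ?thesis using assms by (simp add: commutant_def)
qed

lemma commutant_add:
  assumes "p \<in> commutant Q" "q \<in> commutant Q"
  shows "p \<oplus> q \<in> commutant Q"
  using Q assms by (auto simp: commutant_def l_distr r_distr)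

lemma commutant_minus:
  assumes "p \<in> commutant Q"
  shows "\<ominus> p \<in> commutant Q"
  using Q assms by (auto simp: commutant_def l_minus r_minus)

lemma commutant_diff:
  assumes "p \<in> commutant Q" "q \<in> commutant Q"
  shows "p \<ominus> q \<in> commutant Q"
  unfolding a_minus_def using assms by (intro commutant_add commutant_minus)

lemma commutant_pow:
  assumes "p \<in> commutant Q"
  shows "p [^] (n::nat) \<in> commutant Q"
  by (induction n) (auto simp: assms commutant_one commutant_mult)

end

end

context module_functor
begin

text \<open>The projection onto \<open>K\<close> along \<open>L\<close>, taken by choice at first.
  As \<open>K\<close> and \<open>L\<close> meet in zero, the \<open>K\<close>-part of an element is
  unique (\<open>uniq\<close>), so linearity, naturality and idempotence all follow by exhibiting a
  suitable \<open>K\<close>-part. The last two conclusions are meant for the cases where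
  \<open>\<pi>\<close> is the identity or zero.\<close>

lemma complement_idempotent:
  assumes K: "\<And>x. x \<in> Ob C \<Longrightarrow> submodule (K x) S (M x)"
    and L: "\<And>x. x \<in> Ob C \<Longrightarrow> submodule (L x) S (M x)"
    and farK: "\<And>f m. \<lbrakk>f \<in> Ar C; m \<in> K (Dom C f)\<rbrakk> \<Longrightarrow> far F f m \<in> K (Cod C f)"
    and farL: "\<And>f m. \<lbrakk>f \<in> Ar C; m \<in> L (Dom C f)\<rbrakk> \<Longrightarrow> far F f m \<in> L (Cod C f)"
    and disj: "\<And>x m. \<lbrakk>x \<in> Ob C; m \<in> K x; m \<in> L x\<rbrakk> \<Longrightarrow> m = \<zero>\<^bsub>M x\<^esub>"
    and sum: "\<And>x m. \<lbrakk>x \<in> Ob C; m \<in> carrier (M x)\<rbrakk> \<Longrightarrow> \<exists>k\<in>K x. m \<ominus>\<^bsub>M x\<^esub> k \<in> L x"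
  obtains \<pi> where "\<pi> \<in> carrier E" "\<pi> \<otimes>\<^bsub>E\<^esub> \<pi> = \<pi>"
    and "\<And>x m. \<lbrakk>x \<in> Ob C; m \<in> carrier (M x); \<pi> x m = m\<rbrakk> \<Longrightarrow> m \<in> K x"
    and "\<And>x m. \<lbrakk>x \<in> Ob C; m \<in> carrier (M x); \<pi> x m = \<zero>\<^bsub>M x\<^esub>\<rbrakk> \<Longrightarrow> m \<in> L x"
proof -
  have "\<exists>\<kappa>. \<forall>x m. x \<in> Ob C \<and> m \<in> carrier (M x) \<longrightarrow> \<kappa> x m \<in> K x \<and> m \<ominus>\<^bsub>M x\<^esub> \<kappa> x m \<in> L x"
    using sum by metis
  then obtain \<kappa> where \<kappa>: "\<And>x m. \<lbrakk>x \<in> Ob C; m \<in> carrier (M x)\<rbrakk> \<Longrightarrow> \<kappa> x m \<in> K x"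
    "\<And>x m. \<lbrakk>x \<in> Ob C; m \<in> carrier (M x)\<rbrakk> \<Longrightarrow> m \<ominus>\<^bsub>M x\<^esub> \<kappa> x m \<in> L x"
    by blast
  note K' = module.submoduleE[OF fob_module K] and L' = module.submoduleE[OF fob_module L]
  have Kc: "k \<in> carrier (M x)" if "x \<in> Ob C" "k \<in> K x" for x k
    using K'(1)[OF that(1) that(1)] that(2) by blast
  have uniq: "\<kappa> x m = k" if x: "x \<in> Ob C" and m: "m \<in> carrier (M x)" and k: "k \<in> K x" "m \<ominus>\<^bsub>M x\<^esub> k \<in> L x"
    for x m k
  proof -
    interpret Mx: module S "M x" using fob_module[OF x] .
    have c: "k \<in> carrier (M x)" "\<kappa> x m \<in> carrier (M x)" using Kc[OF x] k \<kappa>[OF x m] by auto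
    let ?d = "k \<ominus>\<^bsub>M x\<^esub> \<kappa> x m"
    \<comment> \<open>The difference of two candidates lies in \<open>K x\<close>; rewritten as the
      difference of their remainders, it lies in \<open>L x\<close> as well.\<close>
    have "?d = (m \<ominus>\<^bsub>M x\<^esub> \<kappa> x m) \<ominus>\<^bsub>M x\<^esub> (m \<ominus>\<^bsub>M x\<^esub> k)"
      using c m by (simp add: a_minus_def Mx.M.minus_add Mx.M.a_ac Mx.M.r_neg1 Mx.M.r_neg2)
    then have "?d \<in> L x" using \<kappa>[OF x m] k L'(3,5)[OF x x] by (simp add: a_minus_def)
    moreover have "?d \<in> K x" using \<kappa>[OF x m] k K'(3,5)[OF x x] by (simp add: a_minus_def)
    ultimately have "?d = \<zero>\<^bsub>M x\<^esub>" using disj x by blast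
    then show ?thesis using c by (metis Mx.M.right_minus_eqD)
  qed
  define \<pi> where "\<pi> = (\<lambda>x\<in>Ob C. \<lambda>m\<in>carrier (M x). \<kappa> x m)"
  have "\<pi> \<in> carrier E" unfolding \<pi>_def
  proof (rule E_closedI)
    fix x assume x: "x \<in> Ob C"
    interpret Mx: module S "M x" using fob_module[OF x] .
    show "\<kappa> x \<in> mod_hom S (M x) (M x)"
    proof (rule mod_homI)
      fix m assume m: "m \<in> carrier (M x)"
      then show "\<kappa> x m \<in> carrier (M x)" using \<kappa> Kc x by blast
    next
      fix m n assume mn: "m \<in> carrier (M x)" "n \<in> carrier (M x)"
      have c: "\<kappa> x m \<in> carrier (M x)" "\<kappa> x n \<in> carrier (M x)" using \<kappa> Kc x mn by blast+
      have "m \<oplus>\<^bsub>M x\<^esub> n \<ominus>\<^bsub>M x\<^esub> (\<kappa> x m \<oplus>\<^bsub>M x\<^esub> \<kappa> x n) = (m \<ominus>\<^bsub>M x\<^esub> \<kappa> x m) \<oplus>\<^bsub>M x\<^esub> (n \<ominus>\<^bsub>M x\<^esub> \<kappa> x n)"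
        using mn c by (simp add: a_minus_def Mx.M.minus_add Mx.M.a_ac)
      then show "\<kappa> x (m \<oplus>\<^bsub>M x\<^esub> n) = \<kappa> x m \<oplus>\<^bsub>M x\<^esub> \<kappa> x n"
        using x mn \<kappa>[OF x mn(1)] \<kappa>[OF x mn(2)] by (intro uniq) (auto intro: K'(5)[OF x x] L'(5)[OF x x])
    next
      fix a m assume am: "a \<in> carrier S" "m \<in> carrier (M x)"
      have c: "\<kappa> x m \<in> carrier (M x)" using \<kappa> Kc x am by blast
      have "a \<odot>\<^bsub>M x\<^esub> m \<ominus>\<^bsub>M x\<^esub> a \<odot>\<^bsub>M x\<^esub> \<kappa> x m = a \<odot>\<^bsub>M x\<^esub> (m \<ominus>\<^bsub>M x\<^esub> \<kappa> x m)"
        using am c by (simp add: a_minus_def Mx.smult_r_distr Mx.smult_r_minus)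
      then show "\<kappa> x (a \<odot>\<^bsub>M x\<^esub> m) = a \<odot>\<^bsub>M x\<^esub> \<kappa> x m"
        using x am \<kappa>[OF x am(2)] by (intro uniq) (auto intro: K'(4)[OF x x] L'(4)[OF x x])
    qed
  next
    fix f m assume f: "f \<in> Ar C" and m: "m \<in> carrier (M (Dom C f))"
    note ob = Dom_closed[OF f] Cod_closed[OF f]
    have "far F f m \<ominus>\<^bsub>M (Cod C f)\<^esub> far F f (\<kappa> (Dom C f) m) = far F f (m \<ominus>\<^bsub>M (Dom C f)\<^esub> \<kappa> (Dom C f) m)"
      using mod_hom_diff[OF fob_module fob_module far_hom] f m ob \<kappa>[OF ob(1) m] Kc by simp
    then show "\<kappa> (Cod C f) (far F f m) = far F f (\<kappa> (Dom C f) m)"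
      using f m ob \<kappa>[OF ob(1) m] by (intro uniq) (auto simp: far_closed farK farL)
  qed
  moreover have "\<pi> \<otimes>\<^bsub>E\<^esub> \<pi> = \<pi>"
  proof (rule E_eqI)
    fix x m assume x: "x \<in> Ob C" and m: "m \<in> carrier (M x)"
    interpret Mx: module S "M x" using fob_module[OF x] .
    have "\<kappa> x m \<in> carrier (M x)" using \<kappa> Kc x m by blast
    moreover have "\<kappa> x (\<kappa> x m) = \<kappa> x m"
      using calculation x \<kappa>[OF x m] L'(2)[OF x x] submodule.axioms(1)[OF L[OF x]]
      by (intro uniq) (auto simp: a_minus_def Mx.M.r_neg subgroup_def)
    ultimately show "(\<pi> \<otimes>\<^bsub>E\<^esub> \<pi>) x m = \<pi> x m" using x m by (simp add: E_mult) (simp add: \<pi>_def)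
  qed (use \<open>\<pi> \<in> carrier E\<close> in auto)
  moreover have "m \<in> K x" if "x \<in> Ob C" "m \<in> carrier (M x)" "\<pi> x m = m" for x m
    using \<kappa>(1)[OF that(1,2)] that by (simp add: \<pi>_def)
  moreover have "m \<in> L x" if "x \<in> Ob C" "m \<in> carrier (M x)" "\<pi> x m = \<zero>\<^bsub>M x\<^esub>" for x m
  proof -
    interpret Mx: module S "M x" using fob_module[OF that(1)] .
    show ?thesis using \<kappa>(2)[OF that(1,2)] that by (simp add: \<pi>_def Mx.M.minus_zero_right)
  qed
  ultimately show ?thesis using that by blast
qed

text \<open>Scalar multiplication is linear because \<open>S\<close> is commutative, and central
  because components are linear. Central elements lie in every commutant, which puts the scalars
  into the bicommutant used in \<open>fitting\<close>.\<close>

lemma scalar_central: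
  assumes "a \<in> carrier S"
  obtains s where "s \<in> carrier E" "\<And>p. p \<in> carrier E \<Longrightarrow> s \<otimes>\<^bsub>E\<^esub> p = p \<otimes>\<^bsub>E\<^esub> s"
    "\<And>x m. \<lbrakk>x \<in> Ob C; m \<in> carrier (M x)\<rbrakk> \<Longrightarrow> s x m = a \<odot>\<^bsub>M x\<^esub> m"
proof
  let ?s = "\<lambda>x\<in>Ob C. \<lambda>m\<in>carrier (M x). a \<odot>\<^bsub>M x\<^esub> m"
  show s: "?s \<in> carrier E"
  proof (rule E_closedI)
    fix x assume x: "x \<in> Ob C"
    interpret Mx: module S "M x" using fob_module[OF x] .
    show "smult (M x) a \<in> mod_hom S (M x) (M x)"
      using assms by (intro mod_homI) (auto simp: Mx.smult_r_distr m_comm simp flip: Mx.smult_assoc1)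
  next
    fix f m assume "f \<in> Ar C" "m \<in> carrier (M (Dom C f))"
    then show "a \<odot>\<^bsub>M (Cod C f)\<^esub> far F f m = far F f (a \<odot>\<^bsub>M (Dom C f)\<^esub> m)"
      using mod_homD(3)[OF far_hom] assms by simp
  qed
  show "?s x m = a \<odot>\<^bsub>M x\<^esub> m" if "x \<in> Ob C" "m \<in> carrier (M x)" for x m using that by simp
  show "?s \<otimes>\<^bsub>E\<^esub> p = p \<otimes>\<^bsub>E\<^esub> ?s" if p: "p \<in> carrier E" for p
  proof (rule E_eqI)
    fix x m assume xm: "x \<in> Ob C" "m \<in> carrier (M x)"
    then have "a \<odot>\<^bsub>M x\<^esub> m \<in> carrier (M x)" using module.smult_closed[OF fob_module] assms by blast
    then show "(?s \<otimes>\<^bsub>E\<^esub> p) x m = (p \<otimes>\<^bsub>E\<^esub> ?s) x m"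
      using xm p assms by (simp add: E_mult E_closed E_apply_smult)
  qed (use p s in auto)
qed

text \<open>As \<open>S\<close> is commutative, the bicommutant \<open>P\<close> of \<open>\<theta>\<close> is a commutative ring that contains the
  scalars. Hence the sets \<open>{(\<theta>\<^sup>k \<otimes> p) x m | p \<in> P}\<close> are submodules, and as they form a descending
  chain, \<open>\<theta>\<^sup>n m = \<theta>\<^sup>n\<^sup>+\<^sup>1 p m\<close> for some \<open>n\<close> and \<open>p \<in> P\<close> that depend on \<open>m\<close>.\<close>

lemma fitting:
  assumes art: "\<And>x. x \<in> Ob C \<Longrightarrow> artinian_module S (M x)" and \<theta>: "\<theta> \<in> carrier E"
  obtains \<pi> where "\<pi> \<in> carrier E" "\<pi> \<otimes>\<^bsub>E\<^esub> \<pi> = \<pi>"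
    "\<pi> = \<one>\<^bsub>E\<^esub> \<Longrightarrow> \<one>\<^bsub>E\<^esub> \<ominus>\<^bsub>E\<^esub> \<theta> \<in> Units E" "\<pi> = \<zero>\<^bsub>E\<^esub> \<Longrightarrow> \<theta> \<in> Units E"
proof -

  \<comment> \<open>The bicommutant and the powers of the endomorphism\<close>
  define P where "P = E.commutant (E.commutant {\<theta>})"
  have Q: "E.commutant {\<theta>} \<subseteq> carrier E" using E.commutant_carrier by blast
  note P = E.commutant_carrier[where Q = "E.commutant {\<theta>}", folded P_def]
    E.commutant_one[OF Q, folded P_def]
    E.commutant_mult[OF Q, folded P_def] E.commutant_add[OF Q, folded P_def]
    E.commutant_minus[OF Q, folded P_def] E.commutant_diff[OF Q, folded P_def]
    E.commutant_pow[OF Q, folded P_def]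
  have P\<theta>: "\<theta> \<in> P" unfolding P_def E.commutant_def using \<theta> by auto
  \<comment> \<open>\<open>\<theta>\<close> belongs to its own commutant, so everything in
    \<open>P\<close> commutes with \<open>\<theta>\<close>. Elements of \<open>P\<close> commute
    with all of \<open>commutant {\<theta>}\<close>, hence with each other.\<close>
  then have "P \<subseteq> E.commutant {\<theta>}" unfolding P_def by (auto simp: E.commutant_def \<theta>)
  then have comm: "p \<otimes>\<^bsub>E\<^esub> q = q \<otimes>\<^bsub>E\<^esub> p" if "p \<in> P" "q \<in> P" for p q
    using that unfolding P_def by (auto simp: E.commutant_def)
  have scal: "\<exists>s\<in>P. \<forall>x\<in>Ob C. \<forall>m\<in>carrier (M x). s x m = a \<odot>\<^bsub>M x\<^esub> m" if "a \<in> carrier S" for a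
  proof -
    from scalar_central[OF that] obtain s where s: "s \<in> carrier E" "\<And>p. p \<in> carrier E \<Longrightarrow> s \<otimes>\<^bsub>E\<^esub> p = p \<otimes>\<^bsub>E\<^esub> s"
      "\<And>x m. \<lbrakk>x \<in> Ob C; m \<in> carrier (M x)\<rbrakk> \<Longrightarrow> s x m = a \<odot>\<^bsub>M x\<^esub> m" by metis
    then have "s \<in> P" unfolding P_def by (auto simp: E.commutant_def)
    with s show ?thesis by blast
  qed
  have commx: "p x (q x m) = q x (p x m)" if "p \<in> P" "q \<in> P" "x \<in> Ob C" "m \<in> carrier (M x)" for p q x m
    using comm[OF that(1,2)] that E_mult by metis
  define \<theta>n where "\<theta>n n = \<theta> [^]\<^bsub>E\<^esub> n" for n :: nat
  have \<theta>n: "\<theta>n n \<in> P" for n unfolding \<theta>n_def by (rule P(7)[OF P\<theta>])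
  have \<theta>n0: "\<theta>n 0 x m = m" if "x \<in> Ob C" "m \<in> carrier (M x)" for x m
    using that by (simp add: \<theta>n_def E_one)
  have \<theta>nS: "\<theta>n (Suc n) x m = \<theta>n n x (\<theta> x m)" if "x \<in> Ob C" "m \<in> carrier (M x)" for x m n
    using that by (simp add: \<theta>n_def E_mult)
  have \<theta>nadd: "\<theta>n (n + k) x m = \<theta>n n x (\<theta>n k x m)" if "x \<in> Ob C" "m \<in> carrier (M x)" for x m n k
  proof -
    have "\<theta>n (n + k) = \<theta>n n \<otimes>\<^bsub>E\<^esub> \<theta>n k" using \<theta> by (simp add: \<theta>n_def E.nat_pow_mult)
    then show ?thesis using that by (simp add: E_mult)
  qed

  \<comment> \<open>The locally nilpotent part and the part with local inverses\<close>
  define K where "K x = {m \<in> carrier (M x). \<exists>n. \<theta>n n x m = \<zero>\<^bsub>M x\<^esub>}" for x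
  \<comment> \<open>The witness \<open>p\<close> inverts \<open>\<theta>\<close> at \<open>m\<close>
    only and varies with \<open>m\<close>; this is why closure under addition takes the construction
    in \<open>addL\<close>.\<close>
  define L where "L x = {m \<in> carrier (M x). \<exists>p\<in>P. \<theta> x (p x m) = m}" for x
  have ann: "m = \<zero>\<^bsub>M x\<^esub>"
    if x: "x \<in> Ob C" and "m \<in> carrier (M x)" "p \<in> P" "\<theta> x (p x m) = m" "\<theta>n n x m = \<zero>\<^bsub>M x\<^esub>" for x m p n
    using that(2-)
  proof (induction n arbitrary: m)
    case 0
    then show ?case using \<theta>n0 x by metis
  next
    case (Suc n)
    \<comment> \<open>The witness \<open>p\<close> also serves \<open>\<theta> x m\<close>, because
      it commutes with \<open>\<theta>\<close>. Once \<open>\<theta> x m\<close> vanishes, so does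
      \<open>m\<close>, being \<open>p\<close> applied to it.\<close>
    have "\<theta> x m = \<zero>\<^bsub>M x\<^esub>"
    proof (rule Suc.IH)
      show "\<theta> x (p x (\<theta> x m)) = \<theta> x m"
        using Suc.prems commx[OF P\<theta> Suc.prems(2) x] x by metis
    qed (use Suc.prems x \<theta> in \<open>auto simp: E_closed \<theta>nS\<close>)
    then show ?case
      using Suc.prems commx[OF P\<theta> Suc.prems(2) x] E_apply_zero[OF P(1)] x by metis
  qed
  have \<theta>n_mono: "\<theta>n (k + n) x m = \<zero>\<^bsub>M x\<^esub>" 
    if "x \<in> Ob C" "m \<in> carrier (M x)" "\<theta>n n x m = \<zero>\<^bsub>M x\<^esub>" for x m n k
    using that by (simp add: \<theta>nadd E_apply_zero[OF P(1)[OF \<theta>n]])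
  have subK: "submodule (K x) S (M x)" if x: "x \<in> Ob C" for x
  proof -
    interpret Mx: module S "M x" using fob_module[OF x] .
    note \<theta>nE = P(1)[OF \<theta>n]
    show ?thesis
    proof (rule Mx.submoduleI)
      fix m n assume "m \<in> K x" "n \<in> K x"
      then obtain i j where "m \<in> carrier (M x)" "n \<in> carrier (M x)"
        "\<theta>n i x m = \<zero>\<^bsub>M x\<^esub>" "\<theta>n j x n = \<zero>\<^bsub>M x\<^esub>" by (auto simp: K_def)
      moreover from this have "\<theta>n (j + i) x (m \<oplus>\<^bsub>M x\<^esub> n) = \<zero>\<^bsub>M x\<^esub>"
        using x \<theta>n_mono[OF x, of m i j] \<theta>n_mono[OF x, of n j i] 
        by (simp add: E_apply[OF \<theta>nE] add.commute)
      ultimately show "m \<oplus>\<^bsub>M x\<^esub> n \<in> K x" by (auto simp: K_def)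
    next
      fix m assume "m \<in> K x"
      then obtain i where "m \<in> carrier (M x)" "\<theta>n i x m = \<zero>\<^bsub>M x\<^esub>" by (auto simp: K_def)
      then show "\<ominus>\<^bsub>M x\<^esub> m \<in> K x"
        using x Mx.M.add.inv_one by (auto simp: K_def E_apply_minus[OF \<theta>nE] intro!: exI[of _ i])
    next
      fix a m assume "a \<in> carrier S" "m \<in> K x"
      then obtain i where "m \<in> carrier (M x)" "\<theta>n i x m = \<zero>\<^bsub>M x\<^esub>" by (auto simp: K_def)
      then show "a \<odot>\<^bsub>M x\<^esub> m \<in> K x"
        using x \<open>a \<in> carrier S\<close> by (auto simp: K_def E_apply_smult[OF \<theta>nE] intro!: exI[of _ i])
    qed (auto simp: K_def E_apply[OF \<theta>nE] x)
  qed
  have addL: "m \<oplus>\<^bsub>M x\<^esub> n \<in> L x" if x: "x \<in> Ob C" and mn: "m \<in> L x" "n \<in> L x" for x m n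
  proof -
    interpret Mx: module S "M x" using fob_module[OF x] .
    from mn obtain p q where p: "p \<in> P" "\<theta> x (p x m) = m" and q: "q \<in> P" "\<theta> x (q x n) = n"
      and c: "m \<in> carrier (M x)" "n \<in> carrier (M x)" by (auto simp: L_def)
    define a where "a = \<theta> \<otimes>\<^bsub>E\<^esub> p"
    define b where "b = \<theta> \<otimes>\<^bsub>E\<^esub> q"
    have ab: "a \<in> P" "b \<in> P" unfolding a_def b_def using P P\<theta> p q by auto
    have abE: "a \<in> carrier E" "b \<in> carrier E" using P ab by auto
    have am: "a x m = m" "b x n = n" using p q x c by (auto simp: a_def b_def E_mult)
    \<comment> \<open>The products \<open>a\<close> and \<open>b\<close> fix \<open>m\<close> and
      \<open>n\<close> respectively, so 1 - (1 - a)(1 - b) = a + b - ab fixes both. Taking out the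
      factor \<open>\<theta>\<close> leaves \<open>r\<close>.\<close>
    define r where "r = p \<oplus>\<^bsub>E\<^esub> q \<ominus>\<^bsub>E\<^esub> p \<otimes>\<^bsub>E\<^esub> (\<theta> \<otimes>\<^bsub>E\<^esub> q)"
    have r: "r \<in> P" unfolding r_def using P P\<theta> p q by auto
    have "\<theta> \<otimes>\<^bsub>E\<^esub> r = a \<oplus>\<^bsub>E\<^esub> b \<ominus>\<^bsub>E\<^esub> a \<otimes>\<^bsub>E\<^esub> b"
      unfolding r_def a_def b_def using P(1)[OF p(1)] P(1)[OF q(1)] \<theta>
      by (simp add: a_minus_def E.r_distr E.r_minus E.m_assoc)
    then have eq: "\<theta> x (r x k) = a x k \<oplus>\<^bsub>M x\<^esub> b x k \<ominus>\<^bsub>M x\<^esub> a x (b x k)" if "k \<in> carrier (M x)" for k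
      using that x abE E_mult[OF x that, of \<theta> r] by (simp add: E_simps)
    have "\<theta> x (r x m) = m \<oplus>\<^bsub>M x\<^esub> b x m \<ominus>\<^bsub>M x\<^esub> b x m"
      using eq c am commx[OF ab x] by simp
    then have "\<theta> x (r x m) = m" using c x abE by (simp add: a_minus_def Mx.M.a_assoc Mx.M.r_neg E_closed)
    moreover have "\<theta> x (r x n) = n"
      using eq[of n] c x abE by (simp add: am a_minus_def E_closed Mx.M.a_comm[of "a x n" n] Mx.M.a_assoc Mx.M.r_neg)
    ultimately have "\<theta> x (r x (m \<oplus>\<^bsub>M x\<^esub> n)) = m \<oplus>\<^bsub>M x\<^esub> n"
      using x c \<theta> P(1)[OF r] by (simp add: E_apply E_closed)
    then show ?thesis using c r by (auto simp: L_def)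
  qed
  have subL: "submodule (L x) S (M x)" if x: "x \<in> Ob C" for x
  proof -
    interpret Mx: module S "M x" using fob_module[OF x] .
    show ?thesis
    proof (rule Mx.submoduleI)
      fix m assume "m \<in> L x"
      then obtain p where "m \<in> carrier (M x)" "p \<in> P" "\<theta> x (p x m) = m" by (auto simp: L_def)
      then show "\<ominus>\<^bsub>M x\<^esub> m \<in> L x"
        using x \<theta> by (auto simp: L_def E_apply E_closed P(1) intro!: bexI[of _ p])
    next
      fix a m assume "a \<in> carrier S" "m \<in> L x"
      then obtain p where "m \<in> carrier (M x)" "p \<in> P" "\<theta> x (p x m) = m" by (auto simp: L_def)
      then show "a \<odot>\<^bsub>M x\<^esub> m \<in> L x"
        using x \<theta> \<open>a \<in> carrier S\<close> by (auto simp: L_def E_apply E_closed P(1) intro!: bexI[of _ p])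
    next
      show "\<zero>\<^bsub>M x\<^esub> \<in> L x" using x \<theta> P(1,2) by (auto simp: L_def E_apply intro!: bexI[of _ "\<one>\<^bsub>E\<^esub>"])
    qed (use x addL in \<open>auto simp: L_def\<close>)
  qed

  \<comment> \<open>The two parts span every module\<close>
  have sum: "\<exists>k\<in>K x. m \<ominus>\<^bsub>M x\<^esub> k \<in> L x" if x: "x \<in> Ob C" and m: "m \<in> carrier (M x)" for x m
  proof -
    interpret Mx: module S "M x" using fob_module[OF x] .
    define N where "N k = {\<theta>n k x (p x m) | p. p \<in> P}" for k
    have "submodule (N k) S (M x)" for k
    proof (rule Mx.submoduleI)
      note \<theta>nE = P(1)[OF \<theta>n]
      show "N k \<subseteq> carrier (M x)" using x m by (auto simp: N_def E_closed[OF P(1)] E_closed[OF \<theta>nE])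
      show "\<zero>\<^bsub>M x\<^esub> \<in> N k"
      proof -
        have "\<one>\<^bsub>E\<^esub> \<ominus>\<^bsub>E\<^esub> \<one>\<^bsub>E\<^esub> \<in> P" by (rule P(6)[OF P(2) P(2)])
        then have "\<zero>\<^bsub>E\<^esub> \<in> P" by (simp add: a_minus_def E.r_neg)
        then show ?thesis using x m by (auto simp: N_def E_zero E_apply_zero[OF \<theta>nE] intro!: exI[of _ "\<zero>\<^bsub>E\<^esub>"])
      qed
    next
      fix u assume "u \<in> N k"
      then obtain p where "p \<in> P" "u = \<theta>n k x (p x m)" by (auto simp: N_def)
      then have "\<ominus>\<^bsub>M x\<^esub> u = \<theta>n k x ((\<ominus>\<^bsub>E\<^esub> p) x m)" "\<ominus>\<^bsub>E\<^esub> p \<in> P"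
        using x m P by (simp_all add: E_minus E_apply[OF P(1)[OF \<theta>n]] E_closed)
      then show "\<ominus>\<^bsub>M x\<^esub> u \<in> N k" unfolding N_def by blast
    next
      fix u v assume "u \<in> N k" "v \<in> N k"
      then obtain p q where "p \<in> P" "u = \<theta>n k x (p x m)" "q \<in> P" "v = \<theta>n k x (q x m)"
        by (auto simp: N_def)
      then have "u \<oplus>\<^bsub>M x\<^esub> v = \<theta>n k x ((p \<oplus>\<^bsub>E\<^esub> q) x m)" "p \<oplus>\<^bsub>E\<^esub> q \<in> P"
        using x m P by (simp_all add: E_add E_apply[OF P(1)[OF \<theta>n]] E_closed)
      then show "u \<oplus>\<^bsub>M x\<^esub> v \<in> N k" unfolding N_def by blast
    next
      fix a u assume a: "a \<in> carrier S" and "u \<in> N k"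
      then obtain p where "p \<in> P" "u = \<theta>n k x (p x m)" by (auto simp: N_def)
      moreover obtain s where "s \<in> P" "\<forall>x\<in>Ob C. \<forall>m\<in>carrier (M x). s x m = a \<odot>\<^bsub>M x\<^esub> m"
        using scal[OF a] by blast
      ultimately have "a \<odot>\<^bsub>M x\<^esub> u = \<theta>n k x ((s \<otimes>\<^bsub>E\<^esub> p) x m)" "s \<otimes>\<^bsub>E\<^esub> p \<in> P"
        using x m a P by (simp_all add: E_mult E_apply[OF P(1)[OF \<theta>n]] E_closed)
      then show "a \<odot>\<^bsub>M x\<^esub> u \<in> N k" unfolding N_def by blast
    qed
    moreover have "N (Suc k) \<subseteq> N k" for k
    proof
      fix u assume "u \<in> N (Suc k)"
      then obtain p where "p \<in> P" "u = \<theta>n (Suc k) x (p x m)" by (auto simp: N_def)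
      then have "u = \<theta>n k x ((\<theta> \<otimes>\<^bsub>E\<^esub> p) x m)" "\<theta> \<otimes>\<^bsub>E\<^esub> p \<in> P"
        using x m P P\<theta> by (simp_all add: E_mult \<theta>nS E_closed)
      then show "u \<in> N k" unfolding N_def by blast
    qed
    ultimately have "\<exists>n. \<forall>k\<ge>n. N k = N n"
      using art[OF x] by (simp add: artinian_module_def)
    then obtain n where n: "\<forall>k\<ge>n. N k = N n" ..
    then have "N (Suc n) = N n" by (rule allE[of _ "Suc n"]) simp
    moreover have "\<theta>n n x m \<in> N n"
      using P(2) x m by (auto simp: N_def E_one intro!: exI[of _ "\<one>\<^bsub>E\<^esub>"])
    ultimately obtain p where p: "p \<in> P" "\<theta>n n x m = \<theta>n (Suc n) x (p x m)" by (auto simp: N_def)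
    define a where "a = \<theta> \<otimes>\<^bsub>E\<^esub> p"
    have a: "a \<in> P" unfolding a_def using P P\<theta> p by auto
    have ax: "a x k = \<theta> x (p x k)" if "k \<in> carrier (M x)" for k using that x by (simp add: a_def E_mult)
    have am: "\<theta>n n x (a x m) = \<theta>n n x m"
      using p x m P(1)[OF p(1)] by (simp add: ax \<theta>nS E_closed)
    \<comment> \<open>The \<open>L\<close>-part of \<open>m\<close> will be \<open>a\<close> to the
      power \<open>n\<close> applied to \<open>m\<close>, where \<open>n\<close> is the stage at
      which the chain stops. Applying \<open>a\<close> to \<open>m\<close> repeatedly does not
      change the value of \<open>\<theta>n n\<close>, so \<open>m\<close> minus this element is
      killed by \<open>\<theta>n n\<close>.\<close>
    define ak where "ak k = a [^]\<^bsub>E\<^esub> k" for k :: nat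
    have ak: "ak k \<in> P" for k unfolding ak_def by (rule P(7)[OF a])
    have akm: "\<theta>n n x (ak k x m) = \<theta>n n x m" for k
    proof (induction k)
      case (Suc k)
      have "\<theta>n n x (ak (Suc k) x m) = \<theta>n n x (ak k x (a x m))"
        using x m by (simp add: ak_def E_mult)
      also have "\<dots> = ak k x (\<theta>n n x (a x m))"
        using commx[OF \<theta>n ak x] x m E_closed P(1)[OF a] by simp
      also have "\<dots> = \<theta>n n x (ak k x m)"
        using commx[OF \<theta>n ak x] x m by (simp add: am)
      finally show ?case using Suc by simp
    qed (use x m in \<open>simp add: ak_def E_one\<close>)
    let ?l = "ak n x m"
    have l: "?l \<in> carrier (M x)" using x m E_closed P(1)[OF ak] by simp
    define pn where "pn = p [^]\<^bsub>E\<^esub> n"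
    have pn: "pn \<in> P" unfolding pn_def by (rule P(7)[OF p(1)])
    \<comment> \<open>The exponent \<open>n\<close> is chosen so that \<open>ak n\<close> contains
      the factor \<open>\<theta>n n\<close>, which does not distinguish \<open>m\<close> from
      \<open>a x m\<close>. Hence \<open>a\<close> fixes \<open>?l\<close>, and \<open>p\<close> is
      the witness for membership in \<open>L x\<close>.\<close>
    have "ak n = pn \<otimes>\<^bsub>E\<^esub> \<theta>n n" unfolding ak_def pn_def \<theta>n_def a_def
      using comm[OF P\<theta> p(1)] P(1)[OF p(1)] \<theta> by (simp add: E.pow_mult_distrib)
    then have ak': "ak n x k = pn x (\<theta>n n x k)" if "k \<in> carrier (M x)" for k
      using that x by (simp add: E_mult)
    have "a x ?l = ak n x (a x m)" using commx[OF a ak x m] .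
    also have "\<dots> = ?l" using am m x P(1)[OF a] by (simp add: ak' E_closed)
    finally have "\<theta> x (p x ?l) = ?l" using ax l by simp
    then have "?l \<in> L x" using l p by (auto simp: L_def)
    moreover have "m \<ominus>\<^bsub>M x\<^esub> ?l \<in> K x"
      using akm[of n] l m x E_closed[OF P(1)[OF \<theta>n] x]
      by (auto simp: K_def E_apply_diff[OF P(1)[OF \<theta>n]] Mx.M.minus_self intro!: exI[of _ n])
    moreover have "m \<ominus>\<^bsub>M x\<^esub> (m \<ominus>\<^bsub>M x\<^esub> ?l) = ?l"
      using l m by (simp add: a_minus_def Mx.M.minus_add Mx.M.r_neg2)
    ultimately show ?thesis by metis
  qed

  \<comment> \<open>The idempotent and its two extreme values\<close>
  obtain \<pi> where \<pi>: "\<pi> \<in> carrier E" "\<pi> \<otimes>\<^bsub>E\<^esub> \<pi> = \<pi>"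
    and \<pi>K: "\<And>x m. \<lbrakk>x \<in> Ob C; m \<in> carrier (M x); \<pi> x m = m\<rbrakk> \<Longrightarrow> m \<in> K x"
    and \<pi>L: "\<And>x m. \<lbrakk>x \<in> Ob C; m \<in> carrier (M x); \<pi> x m = \<zero>\<^bsub>M x\<^esub>\<rbrakk> \<Longrightarrow> m \<in> L x"
  proof (rule complement_idempotent[of K L])
    fix f m assume f: "f \<in> Ar C" 
    note ob = Dom_closed[OF f] Cod_closed[OF f]
    { assume "m \<in> K (Dom C f)"
      then obtain n where "m \<in> carrier (M (Dom C f))" "\<theta>n n (Dom C f) m = \<zero>\<^bsub>M (Dom C f)\<^esub>"
        by (auto simp: K_def)
      then have "\<theta>n n (Cod C f) (far F f m) = \<zero>\<^bsub>M (Cod C f)\<^esub>"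
        using f ob mod_hom_zero[OF fob_module fob_module far_hom] by (simp add: E_natural[OF P(1)[OF \<theta>n]])
      then show "far F f m \<in> K (Cod C f)" using f \<open>m \<in> carrier _\<close> by (auto simp: K_def far_closed)
    }
    { assume "m \<in> L (Dom C f)"
      then obtain p where p: "m \<in> carrier (M (Dom C f))" "p \<in> P" "\<theta> (Dom C f) (p (Dom C f) m) = m"
        by (auto simp: L_def)
      then have "\<theta> (Cod C f) (p (Cod C f) (far F f m)) = far F f m"
        using f ob \<theta> by (simp add: E_natural P(1) E_closed)
      then show "far F f m \<in> L (Cod C f)" using f p by (auto simp: L_def far_closed)
    }
  next
    fix x m assume "x \<in> Ob C" "m \<in> K x" "m \<in> L x"
    then show "m = \<zero>\<^bsub>M x\<^esub>" using ann by (auto simp: K_def L_def)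
  qed (use subK subL sum in auto)
  have "\<one>\<^bsub>E\<^esub> \<ominus>\<^bsub>E\<^esub> \<theta> \<in> Units E" if "\<pi> = \<one>\<^bsub>E\<^esub>"
  proof (rule E_Units)
    fix x assume x: "x \<in> Ob C"
    interpret Mx: module S "M x" using fob_module[OF x] .
    have K: "\<exists>n. \<theta>n n x m = \<zero>\<^bsub>M x\<^esub>" if "m \<in> carrier (M x)" for m
      using \<pi>K[OF x that] that x \<open>\<pi> = _\<close> by (auto simp: K_def E_one)
    have eq: "(\<one>\<^bsub>E\<^esub> \<ominus>\<^bsub>E\<^esub> \<theta>) x m = m \<ominus>\<^bsub>M x\<^esub> \<theta> x m" if "m \<in> carrier (M x)" for m
      using x \<theta> that by (simp add: E_diff E_one)
    have \<theta>c: "\<theta> x m \<in> carrier (M x)" if "m \<in> carrier (M x)" for m using E_closed \<theta> x that by blast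
    have "(\<one>\<^bsub>E\<^esub> \<ominus>\<^bsub>E\<^esub> \<theta>) x m = \<zero>\<^bsub>M x\<^esub> \<Longrightarrow> m = \<zero>\<^bsub>M x\<^esub>" if m: "m \<in> carrier (M x)" for m
    proof -
      assume "(\<one>\<^bsub>E\<^esub> \<ominus>\<^bsub>E\<^esub> \<theta>) x m = \<zero>\<^bsub>M x\<^esub>"
      then have "m = \<theta> x m" using m \<theta>c by (metis eq Mx.M.right_minus_eqD)
      \<comment> \<open>A fixed point of \<open>\<theta>\<close> satisfies the premise of
        \<open>ann\<close> with the identity as witness.\<close>
      then have "\<theta> x (\<one>\<^bsub>E\<^esub> x m) = m" using x m by (simp add: E_one)
      then show "m = \<zero>\<^bsub>M x\<^esub>" using ann[OF x m P(2)] K[OF m] by auto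
    qed
    then have "inj_on ((\<one>\<^bsub>E\<^esub> \<ominus>\<^bsub>E\<^esub> \<theta>) x) (carrier (M x))"
    proof (intro inj_onI)
      fix m n assume mn: "m \<in> carrier (M x)" "n \<in> carrier (M x)" "(\<one>\<^bsub>E\<^esub> \<ominus>\<^bsub>E\<^esub> \<theta>) x m = (\<one>\<^bsub>E\<^esub> \<ominus>\<^bsub>E\<^esub> \<theta>) x n"
      assume *: "\<And>m. \<lbrakk>m \<in> carrier (M x); (\<one>\<^bsub>E\<^esub> \<ominus>\<^bsub>E\<^esub> \<theta>) x m = \<zero>\<^bsub>M x\<^esub>\<rbrakk> \<Longrightarrow> m = \<zero>\<^bsub>M x\<^esub>"
      have "(\<one>\<^bsub>E\<^esub> \<ominus>\<^bsub>E\<^esub> \<theta>) x (m \<ominus>\<^bsub>M x\<^esub> n) = \<zero>\<^bsub>M x\<^esub>"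
        using mn x \<theta> by (simp add: E_apply_diff Mx.M.minus_self E_closed)
      then have "m \<ominus>\<^bsub>M x\<^esub> n = \<zero>\<^bsub>M x\<^esub>" using * mn by simp
      then show "m = n" using mn by (metis Mx.M.right_minus_eqD)
    qed
    \<comment> \<open>In place of the geometric series: if \<open>k\<close> is a preimage of
      \<open>\<theta> x m\<close> under 1 - \<open>\<theta>\<close>, then \<open>m + k\<close> is a
      preimage of \<open>m\<close>.\<close>
    moreover have "m \<in> (\<one>\<^bsub>E\<^esub> \<ominus>\<^bsub>E\<^esub> \<theta>) x ` carrier (M x)" if "m \<in> carrier (M x)" "\<theta>n n x m = \<zero>\<^bsub>M x\<^esub>" for m n
      using that
    proof (induction n arbitrary: m)
      case 0
      then have "m = \<zero>\<^bsub>M x\<^esub>" using \<theta>n0[OF x] by simp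
      moreover have "(\<one>\<^bsub>E\<^esub> \<ominus>\<^bsub>E\<^esub> \<theta>) x \<zero>\<^bsub>M x\<^esub> = \<zero>\<^bsub>M x\<^esub>" using x \<theta> by (intro E_apply_zero) auto
      ultimately show ?case by (metis Mx.M.zero_closed image_eqI)
    next
      case (Suc n)
      then have "\<theta> x m \<in> (\<one>\<^bsub>E\<^esub> \<ominus>\<^bsub>E\<^esub> \<theta>) x ` carrier (M x)"
        using \<theta>nS[OF x] \<theta>c by (intro Suc.IH) simp_all
      then obtain k where k: "k \<in> carrier (M x)" "\<theta> x m = k \<ominus>\<^bsub>M x\<^esub> \<theta> x k"
        using eq by auto
      have "\<theta> x (m \<oplus>\<^bsub>M x\<^esub> k) = k"
        using k(1) Suc.prems(1) \<theta> x \<theta>c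
        by (simp add: E_apply_add k(2) a_minus_def Mx.M.a_assoc Mx.M.l_neg)
      then have "(m \<oplus>\<^bsub>M x\<^esub> k) \<ominus>\<^bsub>M x\<^esub> \<theta> x (m \<oplus>\<^bsub>M x\<^esub> k) = m"
        using k(1) Suc.prems(1) by (simp add: a_minus_def Mx.M.a_assoc Mx.M.r_neg)
      then show ?case using Suc.prems(1) k(1) eq by (metis Mx.M.a_closed image_eqI)
    qed
    moreover have "(\<one>\<^bsub>E\<^esub> \<ominus>\<^bsub>E\<^esub> \<theta>) x ` carrier (M x) \<subseteq> carrier (M x)"
      using E_closed[of "\<one>\<^bsub>E\<^esub> \<ominus>\<^bsub>E\<^esub> \<theta>" x] x \<theta> by blast
    ultimately show "bij_betw ((\<one>\<^bsub>E\<^esub> \<ominus>\<^bsub>E\<^esub> \<theta>) x) (carrier (M x)) (carrier (M x))"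
      using K unfolding bij_betw_def by blast
  qed (use \<theta> in simp)
  moreover have "\<theta> \<in> Units E" if "\<pi> = \<zero>\<^bsub>E\<^esub>"
  proof (rule E_Units)
    fix x assume x: "x \<in> Ob C"
    have L: "\<exists>p\<in>P. \<theta> x (p x m) = m" if "m \<in> carrier (M x)" for m
      using \<pi>L[OF x that] that x \<open>\<pi> = _\<close> by (auto simp: L_def E_zero)
    interpret Mx: module S "M x" using fob_module[OF x] .
    have "inj_on (\<theta> x) (carrier (M x))"
    proof (intro inj_onI)
      fix m n assume mn: "m \<in> carrier (M x)" "n \<in> carrier (M x)" "\<theta> x m = \<theta> x n"
      let ?d = "m \<ominus>\<^bsub>M x\<^esub> n"
      have "\<theta> x ?d = \<zero>\<^bsub>M x\<^esub>" using mn x \<theta> by (simp add: E_apply_diff Mx.M.minus_self E_closed)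
      moreover obtain p where p: "p \<in> P" "\<theta> x (p x ?d) = ?d" using L mn by (metis Mx.M.minus_closed)
      moreover have "\<theta> x (p x ?d) = p x (\<theta> x ?d)" using mn commx[OF P\<theta> p(1) x] by simp
      ultimately have "?d = \<zero>\<^bsub>M x\<^esub>" using E_apply_zero[OF P(1) x] by metis
      then show "m = n" using mn by (metis Mx.M.right_minus_eqD)
    qed
    moreover have "m \<in> \<theta> x ` carrier (M x)" if m: "m \<in> carrier (M x)" for m
    proof -
      obtain p where "p \<in> P" "\<theta> x (p x m) = m" using L m by blast
      then show ?thesis using E_closed[OF P(1) x m] by (metis image_eqI)
    qed
    ultimately show "bij_betw (\<theta> x) (carrier (M x)) (carrier (M x))"
      using E_closed \<theta> x by (auto simp: bij_betw_def)
  qed (fact \<theta>)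
  ultimately show ?thesis using that \<pi> by blast
qed

end

section \<open>Maximal sets of commuting idempotents\<close>

definition (in ring) commuting_idempotents :: "'a set \<Rightarrow> bool"
  where "commuting_idempotents B \<longleftrightarrow>
    B \<subseteq> carrier R \<and> (\<forall>e\<in>B. e \<otimes> e = e) \<and> (\<forall>e\<in>B. \<forall>f\<in>B. e \<otimes> f = f \<otimes> e)"

text \<open>Maximality is stated as absorption of commuting idempotents, the form in which it gets
  applied; \<open>maximal_idempotents_exist\<close> derives it from maximality under
  inclusion.\<close>

locale maximal_idempotents = ring +
  fixes B
  assumes idempotents: "commuting_idempotents B"
    and maximal: "\<lbrakk>p \<in> carrier R; p \<otimes> p = p; \<And>e. e \<in> B \<Longrightarrow> p \<otimes> e = e \<otimes> p\<rbrakk> \<Longrightarrow> p \<in> B"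

text \<open>Zorn's lemma. Commutation concerns two elements at a time, and any two elements of the
  union of a chain lie in a common member.\<close>

lemma (in ring) maximal_idempotents_exist: "\<exists>B. maximal_idempotents R B"
proof -
  have "\<exists>B\<in>Collect commuting_idempotents. \<forall>B'\<in>Collect commuting_idempotents. B \<subseteq> B' \<longrightarrow> B' = B"
  proof (rule subset_Zorn_nonempty)
    have "commuting_idempotents {}" by (simp add: commuting_idempotents_def)
    then show "Collect commuting_idempotents \<noteq> {}" by blast
    fix \<C> assume \<C>: "subset.chain (Collect commuting_idempotents) \<C>"
    then have c: "commuting_idempotents B" if "B \<in> \<C>" for B
      using that by (auto simp: subset_chain_def)
    have "e \<otimes> f = f \<otimes> e" if "e \<in> A" "A \<in> \<C>" "f \<in> B" "B \<in> \<C>" for e f A B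
    proof -
      have "A \<subseteq> B \<or> B \<subseteq> A" using \<C> that by (auto simp: subset_chain_def)
      then show ?thesis
        using c[OF that(2)] c[OF that(4)] that unfolding commuting_idempotents_def by blast
    qed
    then show "\<Union>\<C> \<in> Collect commuting_idempotents"
      using c unfolding commuting_idempotents_def by blast
  qed
  then obtain B where B: "commuting_idempotents B"
    and max: "\<And>B'. \<lbrakk>commuting_idempotents B'; B \<subseteq> B'\<rbrakk> \<Longrightarrow> B' = B" by blast
  have "p \<in> B" if "p \<in> carrier R" "p \<otimes> p = p" "\<And>e. e \<in> B \<Longrightarrow> p \<otimes> e = e \<otimes> p" for p
  proof -
    have "commuting_idempotents (insert p B)"
      using B that unfolding commuting_idempotents_def by auto
    then show ?thesis using max[of "insert p B"] by blast
  qed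
  with B show ?thesis
    by (auto simp: maximal_idempotents_def maximal_idempotents_axioms_def ring_axioms)
qed

context maximal_idempotents
begin

lemma B_carrier: "e \<in> B \<Longrightarrow> e \<in> carrier R"
  and B_idem: "e \<in> B \<Longrightarrow> e \<otimes> e = e"
  and B_comm: "\<lbrakk>e \<in> B; f \<in> B\<rbrakk> \<Longrightarrow> e \<otimes> f = f \<otimes> e"
  using idempotents unfolding commuting_idempotents_def by blast+

text \<open>Together with \<open>B_compl\<close> and \<open>B_mult\<close> this gives
  \<open>B\<close> the structure of a Boolean algebra, with the product as meet.\<close>

lemma B_one: "\<one> \<in> B"
  by (rule maximal) (auto simp: B_carrier)

lemma B_compl:
  assumes "e \<in> B" shows "\<one> \<ominus> e \<in> B"
proof (rule maximal)
  note c = B_carrier[OF assms]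
  show "(\<one> \<ominus> e) \<otimes> (\<one> \<ominus> e) = \<one> \<ominus> e"
    using c B_idem[OF assms] by (simp add: a_minus_def l_distr r_distr l_minus r_minus r_neg)
  show "(\<one> \<ominus> e) \<otimes> f = f \<otimes> (\<one> \<ominus> e)" if "f \<in> B" for f
    using c B_carrier[OF that] B_comm[OF assms that]
    by (simp add: a_minus_def l_distr r_distr l_minus r_minus)
qed (use B_carrier assms in simp)

lemma B_mult:
  assumes "e \<in> B" "f \<in> B" shows "e \<otimes> f \<in> B"
proof (rule maximal)
  note c = B_carrier[OF assms(1)] B_carrier[OF assms(2)]
  have swap: "e \<otimes> f \<otimes> g = g \<otimes> (e \<otimes> f)" if g: "g \<in> B" for g
  proof -
    have "e \<otimes> f \<otimes> g = e \<otimes> g \<otimes> f" using c B_carrier[OF g] B_comm[OF assms(2) g] by (simp add: m_assoc)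
    also have "\<dots> = g \<otimes> (e \<otimes> f)" using c B_carrier[OF g] B_comm[OF assms(1) g] by (simp add: m_assoc)
    finally show ?thesis .
  qed
  then show "\<And>g. g \<in> B \<Longrightarrow> e \<otimes> f \<otimes> g = g \<otimes> (e \<otimes> f)" .
  have "e \<otimes> f \<otimes> (e \<otimes> f) = e \<otimes> f \<otimes> e \<otimes> f" using c by (simp add: m_assoc)
  also have "\<dots> = e \<otimes> e \<otimes> (f \<otimes> f)" using swap[OF assms(1)] c by (simp add: m_assoc)
  finally show "e \<otimes> f \<otimes> (e \<otimes> f) = e \<otimes> f" using B_idem assms by simp
qed (use B_carrier assms in simp)

text \<open>The minimal nonzero elements of \<open>B\<close>, where \<open>e\<close> counts as below
  \<open>f\<close> when \<open>e \<otimes> f = e\<close>.\<close>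

definition atom :: "'a \<Rightarrow> bool"
  where "atom a \<longleftrightarrow> a \<in> B \<and> a \<noteq> \<zero> \<and> (\<forall>b\<in>B. a \<otimes> b = \<zero> \<or> a \<otimes> b = a)"

lemma atom_B: "atom a \<Longrightarrow> a \<in> B"
  by (simp add: atom_def)

lemma atoms_orthogonal:
  assumes "atom a" "atom b" "a \<noteq> b" shows "a \<otimes> b = \<zero>"
  using assms B_comm[of a b] unfolding atom_def by metis

end

section \<open>Atoms in the endomorphism ring\<close>

locale artinian_functor = module_functor +
  assumes artinian: "x \<in> Ob C \<Longrightarrow> artinian_module S (fob F x)"

locale artinian_functor_idempotents = artinian_functor C S F + I: maximal_idempotents "end_ring C S F" B
  for C S F B
begin

abbreviation "im e x \<equiv> e x ` carrier (M x)"

lemma B_idem_apply: "\<lbrakk>e \<in> B; x \<in> Ob C; m \<in> carrier (M x)\<rbrakk> \<Longrightarrow> e x (e x m) = e x m"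
  using I.B_idem E_mult by metis

lemma B_comm_apply:
  "\<lbrakk>e \<in> B; f \<in> B; x \<in> Ob C; m \<in> carrier (M x)\<rbrakk> \<Longrightarrow> e x (f x m) = f x (e x m)"
  using I.B_comm E_mult by metis

lemma B_closed: "\<lbrakk>e \<in> B; x \<in> Ob C; m \<in> carrier (M x)\<rbrakk> \<Longrightarrow> e x m \<in> carrier (M x)"
  using I.B_carrier E_closed by blast

lemma minimal_image:
  assumes x: "x \<in> Ob C" and D: "D \<subseteq> B" "D \<noteq> {}"
  obtains d where "d \<in> D" "\<And>d'. \<lbrakk>d' \<in> D; im d' x \<subseteq> im d x\<rbrakk> \<Longrightarrow> im d' x = im d x"
proof -
  let ?r = "{(N, N'). submodule N S (M x) \<and> submodule N' S (M x) \<and> N \<subset> N'}"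
  let ?Q = "(\<lambda>d. im d x) ` D"
  obtain q where "q \<in> ?Q" using D(2) by blast
  then obtain z where z: "z \<in> ?Q" and min: "\<And>y. (y, z) \<in> ?r \<Longrightarrow> y \<notin> ?Q"
    by (rule wfE_min[OF artinian_module_wf[OF artinian[OF x]]]) (rule that)
  obtain d where d: "d \<in> D" "z = im d x" using z by blast
  have sub: "submodule (im d' x) S (M x)" if "d' \<in> D" for d'
    using submodule_image I.B_carrier that D x by blast
  show ?thesis
  proof (rule that[OF d(1)])
    fix d' assume "d' \<in> D" "im d' x \<subseteq> im d x"
    then show "im d' x = im d x" using min[of "im d' x"] d sub by blast
  qed
qed

text \<open>At each object the images of the members of \<open>D\<close> have a least element, so the limit of the
  downward directed set \<open>D\<close> exists objectwise.\<close>

lemma directed_limit: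
  assumes D: "D \<subseteq> B" "D \<noteq> {}" and Dm: "\<And>d d'. \<lbrakk>d \<in> D; d' \<in> D\<rbrakk> \<Longrightarrow> d \<otimes>\<^bsub>E\<^esub> d' \<in> D"
  obtains a where "a \<in> B" "\<And>d. d \<in> D \<Longrightarrow> a \<otimes>\<^bsub>E\<^esub> d = a"
    "\<And>x. x \<in> Ob C \<Longrightarrow> \<exists>d\<in>D. \<forall>m\<in>carrier (M x). a x m = d x m"
proof -
  have "\<exists>d\<in>D. \<forall>d'\<in>D. \<forall>m\<in>carrier (M x). d' x (d x m) = d x m" if x: "x \<in> Ob C" for x
  proof -
    obtain d where d: "d \<in> D" and min: "\<And>d'. \<lbrakk>d' \<in> D; im d' x \<subseteq> im d x\<rbrakk> \<Longrightarrow> im d' x = im d x"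
      by (rule minimal_image[OF x D]) (rule that)
    \<comment> \<open>Closure under products turns a minimal image into a least one: the product of
      \<open>d'\<close> and \<open>d\<close> has its image inside that of \<open>d\<close>, so the
      images agree and \<open>d'\<close> fixes the image of \<open>d\<close>.\<close>
    have "d' x (d x m) = d x m" if d': "d' \<in> D" and m: "m \<in> carrier (M x)" for d' m
    proof -
      have B: "d \<in> B" "d' \<in> B" using d d' D by auto
      have eq: "(d' \<otimes>\<^bsub>E\<^esub> d) x m = d x (d' x m)" if "m \<in> carrier (M x)" for m
        using that x B B_comm_apply by (simp add: E_mult)
      then have "im (d' \<otimes>\<^bsub>E\<^esub> d) x \<subseteq> im d x" using B_closed[OF B(2) x] by auto
      then have "im (d' \<otimes>\<^bsub>E\<^esub> d) x = im d x" using min Dm d d' by blast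
      then have "d x m \<in> im (d' \<otimes>\<^bsub>E\<^esub> d) x" using m by auto
      then obtain n where "n \<in> carrier (M x)" "d x m = d' x (d x n)" using x by (auto simp: E_mult)
      then show ?thesis using B B_idem_apply[OF B(2) x B_closed[OF B(1) x]] by simp
    qed
    with d show ?thesis by blast
  qed
  then have "\<exists>c. \<forall>x\<in>Ob C. c x \<in> D \<and> (\<forall>d'\<in>D. \<forall>m\<in>carrier (M x). d' x (c x x m) = c x x m)"
    by (intro bchoice) blast
  then obtain c where c: "\<And>x. x \<in> Ob C \<Longrightarrow> c x \<in> D"
    and least: "\<And>x d m. \<lbrakk>x \<in> Ob C; d \<in> D; m \<in> carrier (M x)\<rbrakk> \<Longrightarrow> d x (c x x m) = c x x m"
    by blast
  have cB: "c x \<in> B" if "x \<in> Ob C" for x using c D that by blast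
  define a where "a = (\<lambda>x\<in>Ob C. \<lambda>m\<in>carrier (M x). c x x m)"
  have a: "a x m = c x x m" if "x \<in> Ob C" "m \<in> carrier (M x)" for x m
    using that by (simp add: a_def)
  have aE: "a \<in> carrier E" unfolding a_def
  proof (rule E_closedI)
    show "c x x \<in> mod_hom S (M x) (M x)" if "x \<in> Ob C" for x
      using E_mod_hom[OF I.B_carrier[OF cB]] that by blast
    fix f m assume f: "f \<in> Ar C" and m: "m \<in> carrier (M (Dom C f))"
    let ?x = "Dom C f" let ?y = "Cod C f"
    note ob = Dom_closed[OF f] Cod_closed[OF f]
    note fm = far_closed[OF f m]
    note cx = cB[OF ob(1)] and cy = cB[OF ob(2)]
    \<comment> \<open>The choices at the two ends of \<open>f\<close> are different endomorphisms.
      Each absorbs the other at its own end, and both are natural, so the two can be exchanged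
      across \<open>f\<close>.\<close>
    have "c ?y ?y (far F f m) = c ?x ?y (c ?y ?y (far F f m))"
      using least[OF ob(2) c[OF ob(1)] fm] by simp
    also have "\<dots> = c ?x ?y (far F f (c ?y ?x m))"
      using E_natural[OF I.B_carrier[OF cy] f m] by simp
    also have "\<dots> = far F f (c ?x ?x (c ?y ?x m))"
      using E_natural[OF I.B_carrier[OF cx] f B_closed[OF cy ob(1) m]] by simp
    also have "c ?x ?x (c ?y ?x m) = c ?y ?x (c ?x ?x m)"
      using B_comm_apply[OF cx cy ob(1) m] .
    also have "\<dots> = c ?x ?x m" using least[OF ob(1) c[OF ob(2)] m] .
    finally show "c ?y ?y (far F f m) = far F f (c ?x ?x m)" .
  qed
  have "a \<in> B"
  proof (rule I.maximal[OF aE])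
    show "a \<otimes>\<^bsub>E\<^esub> a = a"
      by (rule E_eqI) (use aE in \<open>auto simp: E_mult a B_closed cB B_idem_apply\<close>)
    show "a \<otimes>\<^bsub>E\<^esub> e = e \<otimes>\<^bsub>E\<^esub> a" if "e \<in> B" for e
      by (rule E_eqI) (use aE I.B_carrier[OF that] that in
          \<open>auto simp: E_mult a B_closed cB B_comm_apply[OF cB]\<close>)
  qed
  moreover have "a \<otimes>\<^bsub>E\<^esub> d = a" if d: "d \<in> D" for d
  proof (rule E_eqI)
    fix x m assume xm: "x \<in> Ob C" "m \<in> carrier (M x)"
    have dB: "d \<in> B" using d D by blast
    have "c x x (d x m) = c x x m"
      using least[OF xm(1) d xm(2)] B_comm_apply[OF dB cB[OF xm(1)] xm] by simp
    then show "(a \<otimes>\<^bsub>E\<^esub> d) x m = a x m" using xm B_closed[OF dB xm] by (simp add: E_mult a)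
  qed (use aE d D I.B_carrier in auto)
  moreover have "\<exists>d\<in>D. \<forall>m\<in>carrier (M x). a x m = d x m" if "x \<in> Ob C" for x
    using a c that by blast
  ultimately show ?thesis using that by blast
qed

text \<open>An \<open>e0\<close> below \<open>e\<close> with minimal nonzero image at
  \<open>x\<close> need not be an atom, as it may still split at other objects. The limit
  \<open>a\<close> of all members of \<open>B\<close> that fix this image is the smallest one with
  the same component as \<open>e0\<close> at \<open>x\<close>, and it is an atom.\<close>

lemma atom_below:
  assumes e: "e \<in> B" and x: "x \<in> Ob C" and m: "m \<in> carrier (M x)" "e x m \<noteq> \<zero>\<^bsub>M x\<^esub>"
  obtains a n where "I.atom a" "a \<otimes>\<^bsub>E\<^esub> e = a" "n \<in> carrier (M x)" "a x n \<noteq> \<zero>\<^bsub>M x\<^esub>"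
proof -
  interpret Mx: module S "M x" using fob_module[OF x] .
  define D0 where "D0 = {d \<in> B. d \<otimes>\<^bsub>E\<^esub> e = d \<and> (\<exists>n\<in>carrier (M x). d x n \<noteq> \<zero>\<^bsub>M x\<^esub>)}"
  have "e \<in> D0" using e m I.B_idem by (auto simp: D0_def)
  then have "D0 \<subseteq> B" "D0 \<noteq> {}" by (auto simp: D0_def)
  then obtain e0 where e0: "e0 \<in> D0"
    and min: "\<And>d'. \<lbrakk>d' \<in> D0; im d' x \<subseteq> im e0 x\<rbrakk> \<Longrightarrow> im d' x = im e0 x"
    by (rule minimal_image[OF x]) (rule that)
  have e0B: "e0 \<in> B" and e0e: "e0 \<otimes>\<^bsub>E\<^esub> e = e0" using e0 by (auto simp: D0_def)
  obtain n where n: "n \<in> carrier (M x)" "e0 x n \<noteq> \<zero>\<^bsub>M x\<^esub>" using e0 by (auto simp: D0_def)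
  define D where "D = {d \<in> B. \<forall>m\<in>carrier (M x). d x (e0 x m) = e0 x m}"
  have D: "D \<subseteq> B" "e0 \<in> D" using e0B B_idem_apply x by (auto simp: D_def)
  obtain a where aB: "a \<in> B" and aD: "\<And>d. d \<in> D \<Longrightarrow> a \<otimes>\<^bsub>E\<^esub> d = a"
    and a: "\<exists>d\<in>D. \<forall>m\<in>carrier (M x). a x m = d x m"
  proof (rule directed_limit[OF D(1)])
    show "D \<noteq> {}" using D by blast
    show "d \<otimes>\<^bsub>E\<^esub> d' \<in> D" if "d \<in> D" "d' \<in> D" for d d'
      using that I.B_mult x B_closed[OF e0B x] by (auto simp: D_def E_mult)
  qed (use x in blast)
  have ax: "a x m = e0 x m" if m: "m \<in> carrier (M x)" for m
  proof -
    have "a x m = a x (e0 x m)" using aD[OF D(2)] x m E_mult by metis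
    then show ?thesis using a B_closed[OF e0B x m] m by (auto simp: D_def)
  qed
  have ae: "a \<otimes>\<^bsub>E\<^esub> e = a"
    using aD[OF D(2)] e0e I.B_carrier[OF aB] I.B_carrier[OF e0B] I.B_carrier[OF e] E.m_assoc by metis
  have "a \<otimes>\<^bsub>E\<^esub> b = \<zero>\<^bsub>E\<^esub> \<or> a \<otimes>\<^bsub>E\<^esub> b = a" if b: "b \<in> B" for b
  \<comment> \<open>By minimality of the image of \<open>e0\<close>, either \<open>b\<close> fixes
    it or \<open>b\<close> kills it. So \<open>b\<close> or its complement lies in \<open>D\<close>
    and absorbs into \<open>a\<close>.\<close>
  proof (cases "\<exists>m\<in>carrier (M x). (a \<otimes>\<^bsub>E\<^esub> b) x m \<noteq> \<zero>\<^bsub>M x\<^esub>")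
    case True
    have "a \<otimes>\<^bsub>E\<^esub> b \<otimes>\<^bsub>E\<^esub> e = a \<otimes>\<^bsub>E\<^esub> b"
      using ae I.B_comm[OF b e] I.B_carrier aB b e by (metis E.m_assoc)
    then have "a \<otimes>\<^bsub>E\<^esub> b \<in> D0" using True I.B_mult[OF aB b] by (auto simp: D0_def)
    moreover have "im (a \<otimes>\<^bsub>E\<^esub> b) x \<subseteq> im e0 x"
      using x B_closed[OF b x] by (auto simp: E_mult ax)
    ultimately have eq: "im (a \<otimes>\<^bsub>E\<^esub> b) x = im e0 x" by (rule min)
    have "b x (e0 x m) = e0 x m" if m: "m \<in> carrier (M x)" for m
    proof -
      have "e0 x m \<in> im (a \<otimes>\<^bsub>E\<^esub> b) x" using eq m by auto
      then obtain k where k: "k \<in> carrier (M x)" "e0 x m = b x (a x k)"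
        using x B_comm_apply[OF aB b] by (auto simp: E_mult)
      then show ?thesis using B_idem_apply[OF b x B_closed[OF aB x k(1)]] by simp
    qed
    then have "b \<in> D" using b by (auto simp: D_def)
    then show ?thesis using aD by blast
  next
    case False
    have "(\<one>\<^bsub>E\<^esub> \<ominus>\<^bsub>E\<^esub> b) x (e0 x m) = e0 x m" if m: "m \<in> carrier (M x)" for m
    proof -
      have "b x (e0 x m) = \<zero>\<^bsub>M x\<^esub>"
        using False m x B_comm_apply[OF aB b x m] by (simp add: ax E_mult)
      then show ?thesis
        using B_closed[OF e0B x m] x I.B_carrier[OF b] by (simp add: E_diff E_one Mx.M.minus_zero_right)
    qed
    then have "\<one>\<^bsub>E\<^esub> \<ominus>\<^bsub>E\<^esub> b \<in> D" using I.B_compl[OF b] by (auto simp: D_def)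
    then have "a \<otimes>\<^bsub>E\<^esub> (\<one>\<^bsub>E\<^esub> \<ominus>\<^bsub>E\<^esub> b) = a" by (rule aD)
    then have "a \<ominus>\<^bsub>E\<^esub> a \<otimes>\<^bsub>E\<^esub> b = a"
      using I.B_carrier[OF aB] I.B_carrier[OF b] by (simp add: a_minus_def E.r_distr E.r_minus)
    then have "\<ominus>\<^bsub>E\<^esub> (a \<otimes>\<^bsub>E\<^esub> b) = \<zero>\<^bsub>E\<^esub>"
      using I.B_carrier[OF aB] I.B_carrier[OF b] by (simp add: a_minus_def)
    then show ?thesis
      using I.B_carrier[OF aB] I.B_carrier[OF b] by (metis E.m_closed E.minus_minus E.minus_zero)
  qed
  moreover have "a \<noteq> \<zero>\<^bsub>E\<^esub>" using n ax x by (auto simp: E_zero)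
  ultimately have "I.atom a" using aB by (simp add: I.atom_def)
  then show ?thesis using that ae n ax by metis
qed

text \<open>Induction on the image at \<open>x\<close>: an atom \<open>a\<close> below
  \<open>e\<close> that is nonzero at \<open>x\<close> is split off. The image of the rest is
  strictly smaller, because \<open>a\<close> annihilates the rest but not its own image at
  \<open>x\<close>.\<close>

lemma atomic_sum:
  assumes "x \<in> Ob C" "e \<in> B"
  shows "\<exists>T. finite T \<and> (\<forall>a\<in>T. I.atom a \<and> a \<otimes>\<^bsub>E\<^esub> e = a) \<and>
    (\<forall>m\<in>carrier (M x). e x m = (\<Oplus>\<^bsub>M x\<^esub>a\<in>T. a x m))"
  using assms(2)
proof (induction "im e x" arbitrary: e rule: wf_induct_rule[OF artinian_module_wf[OF artinian[OF assms(1)]]])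
  case (1 e)
  interpret Mx: module S "M x" using fob_module[OF assms(1)] .
  note x = assms(1) and e = \<open>e \<in> B\<close>
  show ?case
  proof (cases "\<exists>m\<in>carrier (M x). e x m \<noteq> \<zero>\<^bsub>M x\<^esub>")
    case False
    then show ?thesis by (intro exI[of _ "{}"]) simp
  next
    case True
    then obtain a n where a: "I.atom a" "a \<otimes>\<^bsub>E\<^esub> e = a" and n: "n \<in> carrier (M x)" "a x n \<noteq> \<zero>\<^bsub>M x\<^esub>"
      using atom_below[OF e x] by metis
    have aB: "a \<in> B" using I.atom_B[OF a(1)] .
    note c = I.B_carrier[OF aB] I.B_carrier[OF e]
    have aex: "a x (e x m) = a x m" if "m \<in> carrier (M x)" for m using a(2) that x E_mult by metis
    then have eax: "e x (a x m) = a x m" if "m \<in> carrier (M x)" for m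
      using B_comm_apply[OF aB e x] that by metis
    \<comment> \<open>This is \<open>e\<close> minus \<open>a\<close>, written as a product so that
      membership in \<open>B\<close> comes from \<open>B_mult\<close> and
      \<open>B_compl\<close>.\<close>
    define e' where "e' = e \<otimes>\<^bsub>E\<^esub> (\<one>\<^bsub>E\<^esub> \<ominus>\<^bsub>E\<^esub> a)"
    have e': "e' \<in> B" unfolding e'_def using I.B_mult I.B_compl e aB by blast
    have e'x: "e' x m = e x m \<ominus>\<^bsub>M x\<^esub> a x m" if "m \<in> carrier (M x)" for m
      using that x c eax E_closed by (simp add: e'_def E_mult E_diff E_one E_apply_diff)
    have ae': "a \<otimes>\<^bsub>E\<^esub> e' = \<zero>\<^bsub>E\<^esub>"
    proof (rule E_eqI)
      fix y m assume ym: "y \<in> Ob C" "m \<in> carrier (M y)"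
      interpret My: module S "M y" using fob_module[OF ym(1)] .
      have "a y (e y k) = a y k" if "k \<in> carrier (M y)" for k using a(2) that ym E_mult by metis
      then show "(a \<otimes>\<^bsub>E\<^esub> e') y m = \<zero>\<^bsub>E\<^esub> y m"
        using ym c B_idem_apply[OF aB ym] 
        by (simp add: e'_def E_simps E_closed E_apply_diff My.M.minus_self)
    qed (use c I.B_carrier[OF e'] in auto)
    have "im e' x \<subset> im e x"
    proof (rule psubsetI)
      have "e' x m = e x (e' x m)" if "m \<in> carrier (M x)" for m
        using that x c eax B_idem_apply[OF e x that] E_closed by (simp add: e'x E_apply_diff)
      then show "im e' x \<subseteq> im e x" using B_closed[OF e' x] by blast
      have "a x n \<in> im e x" using eax[OF n(1)] B_closed[OF aB x n(1)] by force
      moreover have "a x n \<notin> im e' x"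
      proof
        assume "a x n \<in> im e' x"
        then obtain k where k: "k \<in> carrier (M x)" "a x n = e' x k" by blast
        then have "a x (a x n) = (a \<otimes>\<^bsub>E\<^esub> e') x k" using x by (simp add: E_mult)
        then show False using ae' k x n B_idem_apply[OF aB x n(1)] by (simp add: E_zero)
      qed
      ultimately show "im e' x \<noteq> im e x" by blast
    qed
    then have "(im e' x, im e x) \<in> {(N, N'). submodule N S (M x) \<and> submodule N' S (M x) \<and> N \<subset> N'}"
      using submodule_image I.B_carrier x e e' by simp
    from 1(1)[OF this e'] obtain T where T: "finite T" "\<And>b. b \<in> T \<Longrightarrow> I.atom b \<and> b \<otimes>\<^bsub>E\<^esub> e' = b"
      "\<And>m. m \<in> carrier (M x) \<Longrightarrow> e' x m = (\<Oplus>\<^bsub>M x\<^esub>b\<in>T. b x m)" by blast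
    have "a \<notin> T" using T(2) ae' a(1) by (auto simp: I.atom_def)
    have "e x m = (\<Oplus>\<^bsub>M x\<^esub>b\<in>insert a T. b x m)" if m: "m \<in> carrier (M x)" for m
    proof -
      have "(\<Oplus>\<^bsub>M x\<^esub>b\<in>insert a T. b x m) = a x m \<oplus>\<^bsub>M x\<^esub> e' x m"
        using T \<open>a \<notin> T\<close> m x c B_closed[OF I.atom_B] by (subst Mx.M.finsum_insert) (auto simp: E_closed)
      also have "\<dots> = e x m"
        using m x c by (simp add: e'x a_minus_def E_closed Mx.M.a_comm[of "e x m"] Mx.M.r_neg2)
      finally show ?thesis by simp
    qed
    moreover have "b \<otimes>\<^bsub>E\<^esub> e = b" if "b \<in> T" for b
    proof -
      have "e' \<otimes>\<^bsub>E\<^esub> e = e'"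
        using I.B_comm[OF e' e] I.B_idem[OF e] c I.B_carrier[OF I.B_compl[OF aB]]
        by (simp add: e'_def flip: E.m_assoc)
      then show ?thesis
        using T(2)[OF that] I.B_carrier[OF I.atom_B] I.B_carrier[OF e'] c E.m_assoc by metis
    qed
    ultimately show ?thesis using T a by (intro exI[of _ "insert a T"]) auto
  qed
qed

end

section \<open>Decomposition into strongly indecomposable functors\<close>

text \<open>Depends on the family of carriers alone, so that \<open>subfunctor F\<close> itself is
  the family of summands when these are indexed by their carriers.\<close>

definition subfunctor :: "('o, 'a, 's, 'm) mod_functor \<Rightarrow> ('o \<Rightarrow> 'm set) \<Rightarrow> ('o, 'a, 's, 'm) mod_functor"
  where "subfunctor F U = F\<lparr>fob := \<lambda>x. (fob F x)\<lparr>carrier := U x\<rparr>\<rparr>"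

lemma far_subfunctor [simp]: "far (subfunctor F U) = far F"
  by (simp add: subfunctor_def)

lemma fob_subfunctor: "fob (subfunctor F U) x = (fob F x)\<lparr>carrier := U x\<rparr>"
  by (simp add: subfunctor_def)

lemma subfunctor_simps [simp]:
  "carrier (fob (subfunctor F U) x) = U x"
  "\<zero>\<^bsub>fob (subfunctor F U) x\<^esub> = \<zero>\<^bsub>fob F x\<^esub>"
  "m \<oplus>\<^bsub>fob (subfunctor F U) x\<^esub> n = m \<oplus>\<^bsub>fob F x\<^esub> n"
  "s \<odot>\<^bsub>fob (subfunctor F U) x\<^esub> m = s \<odot>\<^bsub>fob F x\<^esub> m"
  by (simp_all add: fob_subfunctor)

lemma (in module_functor) subfunctor_module_functor:
  assumes sub: "\<And>x. x \<in> Ob C \<Longrightarrow> submodule (U x) S (fob F x)"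
    and far: "\<And>f m. \<lbrakk>f \<in> Ar C; m \<in> U (Dom C f)\<rbrakk> \<Longrightarrow> far F f m \<in> U (Cod C f)"
  shows "module_functor C S (subfunctor F U)"
proof -
  have U: "U x \<subseteq> carrier (M x)" if "x \<in> Ob C" for x
    using module.submoduleE(1)[OF fob_module sub] that by blast
  show ?thesis
  proof (intro module_functor.intro module_functor_axioms.intro)
    show "module S (fob (subfunctor F U) x)" if "x \<in> Ob C" for x
      using submodule.submodule_is_module[OF sub fob_module] that by (simp add: fob_subfunctor)
    show "far (subfunctor F U) f \<in> mod_hom S (fob (subfunctor F U) (Dom C f)) (fob (subfunctor F U) (Cod C f))"
      if f: "f \<in> Ar C" for f
      using far[OF f] mod_homD(2,3)[OF far_hom[OF f]] subsetD[OF U[OF Dom_closed[OF f]]] by (intro mod_homI) auto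
    show "far (subfunctor F U) (Idn C x) m = m" if "x \<in> Ob C" "m \<in> carrier (fob (subfunctor F U) x)" for x m
      using far_Idn that U by auto
    show "far (subfunctor F U) (Cmp C g f) m = far (subfunctor F U) g (far (subfunctor F U) f m)"
      if "f \<in> Ar C" "g \<in> Ar C" "Cod C f = Dom C g" "m \<in> carrier (fob (subfunctor F U) (Dom C f))" for f g m
      using far_Cmp[OF that(1-3)] that(4) subsetD[OF U[OF Dom_closed[OF that(1)]]] by simp
  qed (fact small_category_axioms is_cring)+
qed

context artinian_functor_idempotents
begin

abbreviation "summand a \<equiv> subfunctor F (\<lambda>x. im a x)"

lemma summand_artinian_functor:
  assumes a: "a \<in> B"
  shows "artinian_functor C S (summand a)"
proof -
  have sub: "submodule (im a x) S (M x)" if "x \<in> Ob C" for x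
    using submodule_image I.B_carrier a that by blast
  have "module_functor C S (summand a)"
  proof (rule subfunctor_module_functor[OF sub])
    fix f m assume f: "f \<in> Ar C" and "m \<in> im a (Dom C f)"
    then obtain n where n: "n \<in> carrier (M (Dom C f))" "m = a (Dom C f) n" by blast
    then have "far F f m = a (Cod C f) (far F f n)" using f E_natural I.B_carrier[OF a] by simp
    then show "far F f m \<in> im a (Cod C f)" using far_closed[OF f n(1)] by blast
  qed
  moreover have "artinian_module S (fob (summand a) x)" if "x \<in> Ob C" for x
    using artinian_submodule[OF artinian sub] that by (simp add: fob_subfunctor)
  ultimately show ?thesis by (simp add: artinian_functor_def artinian_functor_axioms_def)
qed

text \<open>An idempotent endomorphism \<open>\<pi>\<close> of the summand extends to the idempotent \<open>\<pi> \<circ> a\<close> of \<open>F\<close>, which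
  commutes with \<open>B\<close> because \<open>a\<close> is an atom.\<close>

lemma summand_idempotent:
  assumes a: "I.atom a" and \<pi>: "\<pi> \<in> carrier (end_ring C S (summand a))"
    and idem: "\<pi> \<otimes>\<^bsub>end_ring C S (summand a)\<^esub> \<pi> = \<pi>"
  shows "\<pi> = \<zero>\<^bsub>end_ring C S (summand a)\<^esub> \<or> \<pi> = \<one>\<^bsub>end_ring C S (summand a)\<^esub>"
proof -
  have aB: "a \<in> B" and aE: "a \<in> carrier E" using I.atom_B[OF a] I.B_carrier by auto
  interpret G: artinian_functor C S "summand a" by (rule summand_artinian_functor[OF aB])
  have im: "u \<in> carrier (M x)" "a x u = u" if "x \<in> Ob C" "u \<in> im a x" for x u
    using that B_closed[OF aB] B_idem_apply[OF aB] by auto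
  have ax: "a x m \<in> im a x" if "m \<in> carrier (M x)" for x m using that by blast
  have \<pi>c: "\<pi> x u \<in> im a x" if "x \<in> Ob C" "u \<in> im a x" for x u
    using G.E_closed[OF \<pi>] that by simp
  have \<pi>i: "\<pi> x (\<pi> x u) = \<pi> x u" if "x \<in> Ob C" "u \<in> im a x" for x u
    using G.E_mult[of x u \<pi> \<pi>] that idem by simp
  define p where "p = (\<lambda>x\<in>Ob C. \<lambda>m\<in>carrier (M x). \<pi> x (a x m))"
  have px: "p x m = \<pi> x (a x m)" if "x \<in> Ob C" "m \<in> carrier (M x)" for x m
    using that by (simp add: p_def)
  have pE: "p \<in> carrier E" unfolding p_def
  proof (rule E_closedI)
    fix x assume x: "x \<in> Ob C"
    interpret Mx: module S "M x" using fob_module[OF x] .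
    have h: "\<pi> x (u \<oplus>\<^bsub>M x\<^esub> u') = \<pi> x u \<oplus>\<^bsub>M x\<^esub> \<pi> x u'" "\<pi> x (s \<odot>\<^bsub>M x\<^esub> u) = s \<odot>\<^bsub>M x\<^esub> \<pi> x u"
      if "u \<in> im a x" "u' \<in> im a x" "s \<in> carrier S" for u u' s
      using G.E_apply_add[OF \<pi> x, of u u'] G.E_apply_smult[OF \<pi> x, of s u] that
      unfolding subfunctor_simps by blast+
    show "(\<lambda>m. \<pi> x (a x m)) \<in> mod_hom S (M x) (M x)"
    proof (rule mod_homI)
      fix m n assume mn: "m \<in> carrier (M x)" "n \<in> carrier (M x)"
      show "\<pi> x (a x m) \<in> carrier (M x)" using im(1)[OF x \<pi>c[OF x ax[OF mn(1)]]] .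
      show "\<pi> x (a x (m \<oplus>\<^bsub>M x\<^esub> n)) = \<pi> x (a x m) \<oplus>\<^bsub>M x\<^esub> \<pi> x (a x n)"
        unfolding E_apply_add[OF aE x mn] by (rule h(1)[OF ax[OF mn(1)] ax[OF mn(2)] zero_closed])
    next
      fix s m assume sm: "s \<in> carrier S" "m \<in> carrier (M x)"
      show "\<pi> x (a x (s \<odot>\<^bsub>M x\<^esub> m)) = s \<odot>\<^bsub>M x\<^esub> \<pi> x (a x m)"
        unfolding E_apply_smult[OF aE x sm] by (rule h(2)[OF ax[OF sm(2)] ax[OF sm(2)] sm(1)])
    qed
  next
    fix f m assume f: "f \<in> Ar C" and m: "m \<in> carrier (M (Dom C f))"
    have "a (Dom C f) m \<in> carrier (fob (summand a) (Dom C f))" using m by simp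
    from G.E_natural[OF \<pi> f this]
    show "\<pi> (Cod C f) (a (Cod C f) (far F f m)) = far F f (\<pi> (Dom C f) (a (Dom C f) m))"
      unfolding E_natural[OF aE f m] by simp
  qed
  have pc: "p x m \<in> im a x" if "x \<in> Ob C" "m \<in> carrier (M x)" for x m
    using that px \<pi>c ax by simp
  have "p \<in> B"
  proof (rule I.maximal[OF pE])
    show "p \<otimes>\<^bsub>E\<^esub> p = p"
    proof (rule E_eqI)
      fix x m assume xm: "x \<in> Ob C" "m \<in> carrier (M x)"
      have "p x (p x m) = \<pi> x (p x m)" using im[OF xm(1) pc[OF xm]] xm by (simp add: px)
      then show "(p \<otimes>\<^bsub>E\<^esub> p) x m = p x m" using xm \<pi>i ax by (simp add: E_mult px)
    qed (use pE in auto)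
    fix b assume b: "b \<in> B"
    note bE = I.B_carrier[OF b]
    show "p \<otimes>\<^bsub>E\<^esub> b = b \<otimes>\<^bsub>E\<^esub> p"
    proof (rule E_eqI)
      fix x m assume xm: "x \<in> Ob C" "m \<in> carrier (M x)"
      \<comment> \<open>Both products of \<open>p\<close> and \<open>b\<close> are expressed through
        the product of \<open>a\<close> and \<open>b\<close>, which is zero or \<open>a\<close>
        since \<open>a\<close> is an atom.\<close>
      have l: "p x (b x m) = \<pi> x ((a \<otimes>\<^bsub>E\<^esub> b) x m)"
        using xm E_closed[OF bE] by (simp add: px E_mult)
      have pm: "p x m \<in> carrier (M x)" using E_closed[OF pE xm] .
      have "b x (p x m) = b x (a x (p x m))" using im(2)[OF xm(1) pc[OF xm]] by simp
      also have "\<dots> = (a \<otimes>\<^bsub>E\<^esub> b) x (p x m)" using xm pm B_comm_apply[OF b aB] by (simp add: E_mult)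
      finally have r: "b x (p x m) = (a \<otimes>\<^bsub>E\<^esub> b) x (p x m)" .
      have "a \<otimes>\<^bsub>E\<^esub> b = \<zero>\<^bsub>E\<^esub> \<or> a \<otimes>\<^bsub>E\<^esub> b = a" using a b by (simp add: I.atom_def)
      then show "(p \<otimes>\<^bsub>E\<^esub> b) x m = (b \<otimes>\<^bsub>E\<^esub> p) x m"
      proof
        assume "a \<otimes>\<^bsub>E\<^esub> b = \<zero>\<^bsub>E\<^esub>"
        then show ?thesis using xm l r pm G.E_apply_zero[OF \<pi> xm(1)] by (simp add: E_mult E_zero)
      next
        assume "a \<otimes>\<^bsub>E\<^esub> b = a"
        then show ?thesis using xm l r im(2)[OF xm(1) pc[OF xm]] by (simp add: E_mult px)
      qed
    qed (use pE bE in auto)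
  qed
  moreover have "a \<otimes>\<^bsub>E\<^esub> p = p"
    by (rule E_eqI) (use aE pE im(2)[OF _ pc] in \<open>auto simp: E_mult\<close>)
  ultimately have "p = \<zero>\<^bsub>E\<^esub> \<or> p = a" using a by (auto simp: I.atom_def)
  then show ?thesis
  proof
    assume p: "p = \<zero>\<^bsub>E\<^esub>"
    have "\<pi> = \<zero>\<^bsub>end_ring C S (summand a)\<^esub>"
    proof (rule G.E_eqI[OF \<pi>])
      fix x u assume x: "x \<in> Ob C" and "u \<in> carrier (fob (summand a) x)"
      then have u: "u \<in> im a x" by simp
      have "\<pi> x u = p x u" using im[OF x u] x by (simp add: px)
      then show "\<pi> x u = \<zero>\<^bsub>end_ring C S (summand a)\<^esub> x u"
        using p x u im(1)[OF x u] by (simp add: E_zero G.E_zero)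
    qed simp
    then show ?thesis ..
  next
    assume p: "p = a"
    have "\<pi> = \<one>\<^bsub>end_ring C S (summand a)\<^esub>"
    proof (rule G.E_eqI[OF \<pi>])
      fix x u assume x: "x \<in> Ob C" and "u \<in> carrier (fob (summand a) x)"
      then have u: "u \<in> im a x" by simp
      have "\<pi> x u = p x u" using im[OF x u] x by (simp add: px)
      then show "\<pi> x u = \<one>\<^bsub>end_ring C S (summand a)\<^esub> x u"
        using p x u im(2)[OF x u] by (simp add: G.E_one)
    qed simp
    then show ?thesis ..
  qed
qed

text \<open>By \<open>summand_idempotent\<close> the idempotent that \<open>fitting\<close> attaches
  to \<open>t\<close> is zero or the identity; in the first case \<open>t\<close> is a unit, in the
  second its complement. The ring is nonzero because an atom is.\<close>

lemma summand_strongly_indecomposable: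
  assumes a: "I.atom a"
  shows "strongly_indecomposable C S (summand a)"
proof -
  have aB: "a \<in> B" using I.atom_B[OF a] .
  interpret G: artinian_functor C S "summand a" by (rule summand_artinian_functor[OF aB])
  have "local_ring (end_ring C S (summand a))"
  proof (rule G.E.local_ringI)
    show "\<one>\<^bsub>end_ring C S (summand a)\<^esub> \<noteq> \<zero>\<^bsub>end_ring C S (summand a)\<^esub>"
    proof
      assume eq: "\<one>\<^bsub>end_ring C S (summand a)\<^esub> = \<zero>\<^bsub>end_ring C S (summand a)\<^esub>"
      have "a = \<zero>\<^bsub>E\<^esub>"
      proof (rule E_eqI)
        fix x m assume xm: "x \<in> Ob C" "m \<in> carrier (M x)"
        then have c: "a x m \<in> carrier (fob (summand a) x)" by simp
        show "a x m = \<zero>\<^bsub>E\<^esub> x m"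
          using G.E_one[OF xm(1) c] G.E_zero[OF xm(1) c] by (simp add: eq E_zero[OF xm])
      qed (use aB I.B_carrier in auto)
      then show False using a by (simp add: I.atom_def)
    qed
    fix t assume t: "t \<in> carrier (end_ring C S (summand a))"
    show "t \<in> Units (end_ring C S (summand a)) \<or>
        \<one>\<^bsub>end_ring C S (summand a)\<^esub> \<ominus>\<^bsub>end_ring C S (summand a)\<^esub> t \<in> Units (end_ring C S (summand a))"
      by (rule G.fitting[OF G.artinian t]) (use summand_idempotent[OF a] in blast)+
  qed
  then show ?thesis by (simp add: strongly_indecomposable_def G.module_functor_axioms)
qed

lemma E_apply_finsum:
  assumes "p \<in> carrier E" "x \<in> Ob C" "finite T" "f \<in> T \<rightarrow> carrier (M x)"
  shows "p x (\<Oplus>\<^bsub>M x\<^esub>i\<in>T. f i) = (\<Oplus>\<^bsub>M x\<^esub>i\<in>T. p x (f i))"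
proof -
  interpret Mx: module S "M x" using fob_module[OF assms(2)] .
  show ?thesis using assms(3,4)
  proof induction
    case (insert i T)
    then show ?case using assms(1,2)
      by (subst (1 2) Mx.M.finsum_insert) (auto simp: E_apply_add E_closed Pi_iff)
  qed (use assms E_apply_zero in simp)
qed

text \<open>Applying a further atom to the finite sum of atoms that represents the identity at
  \<open>x\<close> gives zero by orthogonality. This is the source of the finite supports in the
  direct sum.\<close>

lemma finite_atoms:
  assumes x: "x \<in> Ob C"
  obtains T where "finite T" "\<And>a. a \<in> T \<Longrightarrow> I.atom a"
    "\<And>m. m \<in> carrier (M x) \<Longrightarrow> (\<Oplus>\<^bsub>M x\<^esub>a\<in>T. a x m) = m"
    "\<And>a m. \<lbrakk>I.atom a; a \<notin> T; m \<in> carrier (M x)\<rbrakk> \<Longrightarrow> a x m = \<zero>\<^bsub>M x\<^esub>"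
proof -
  interpret Mx: module S "M x" using fob_module[OF x] .
  obtain T where T: "finite T" "\<And>a. a \<in> T \<Longrightarrow> I.atom a"
    "\<And>m. m \<in> carrier (M x) \<Longrightarrow> (\<Oplus>\<^bsub>M x\<^esub>a\<in>T. a x m) = m"
    using atomic_sum[OF x I.B_one] E_one[OF x] by metis
  have "a x m = \<zero>\<^bsub>M x\<^esub>" if a: "I.atom a" "a \<notin> T" and m: "m \<in> carrier (M x)" for a m
  proof -
    have "a x (b x m) = \<zero>\<^bsub>M x\<^esub>" if "b \<in> T" for b
    proof -
      have "a \<noteq> b" using that a(2) by blast
      then have "a \<otimes>\<^bsub>E\<^esub> b = \<zero>\<^bsub>E\<^esub>" by (rule I.atoms_orthogonal[OF a(1) T(2)[OF that]])
      then show ?thesis using E_mult[OF x m, of a b] E_zero[OF x m] by simp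
    qed
    then have "(\<Oplus>\<^bsub>M x\<^esub>b\<in>T. a x (b x m)) = (\<Oplus>\<^bsub>M x\<^esub>b\<in>T. \<zero>\<^bsub>M x\<^esub>)"
      by (intro Mx.M.finsum_cong') auto
    moreover have "a x (\<Oplus>\<^bsub>M x\<^esub>b\<in>T. b x m) = (\<Oplus>\<^bsub>M x\<^esub>b\<in>T. a x (b x m))"
      using B_closed[OF I.atom_B[OF T(2)] x m] I.B_carrier[OF I.atom_B[OF a(1)]]
      by (intro E_apply_finsum x T(1)) auto
    ultimately show ?thesis using T(3)[OF m] by simp
  qed
  with T show ?thesis using that by blast
qed

text \<open>Allows summands to be indexed by their images. If the images agree, \<open>b\<close>
  fixes the image of \<open>a\<close>, whereas distinct atoms are orthogonal.\<close>

lemma atom_eqI: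
  assumes "I.atom a" "I.atom b" "(\<lambda>x. im a x) = (\<lambda>x. im b x)"
  shows "a = b"
proof (rule ccontr)
  assume "a \<noteq> b"
  then have ba: "b \<otimes>\<^bsub>E\<^esub> a = \<zero>\<^bsub>E\<^esub>" using I.atoms_orthogonal assms by metis
  have "a = \<zero>\<^bsub>E\<^esub>"
  proof (rule E_eqI)
    fix x m assume xm: "x \<in> Ob C" "m \<in> carrier (M x)"
    have "a x m \<in> im b x" using xm fun_cong[OF assms(3), of x] by blast
    then have "b x (a x m) = a x m" using B_idem_apply[OF I.atom_B[OF assms(2)] xm(1)] by auto
    then show "a x m = \<zero>\<^bsub>E\<^esub> x m" using ba E_mult[OF xm, of b a] by simp
  qed (use I.B_carrier[OF I.atom_B] assms in auto)
  then show False using assms(1) by (simp add: I.atom_def)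
qed

text \<open>The isomorphism sends an element to the family of its components under all atoms. That
  it is well defined and bijective at \<open>x\<close> comes down to the finitely many atoms that
  act there.\<close>

lemma decomposition:
  assumes "Is = (\<lambda>a x. im a x) ` Collect I.atom"
  shows "functor_iso C S F (functor_direct_sum Is (subfunctor F))"
proof -
  \<comment> \<open>Recovers the atom from its family of images, which is the index.\<close>
  define \<alpha> where "\<alpha> = inv_into (Collect I.atom) (\<lambda>a x. im a x)"
  let ?D = "functor_direct_sum Is (subfunctor F)"
  have inj: "inj_on (\<lambda>a x. im a x) (Collect I.atom)" using atom_eqI by (intro inj_onI) simp
  have \<alpha>: "I.atom (\<alpha> i)" "im (\<alpha> i) x = i x" if "i \<in> Is" for i x
    using inv_into_into[of i "\<lambda>a x. im a x" "Collect I.atom"]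
      fun_cong[OF f_inv_into_f[of i "\<lambda>a x. im a x" "Collect I.atom"], of x] that assms
    by (auto simp: \<alpha>_def)
  have \<alpha>_im: "\<alpha> (\<lambda>x. im a x) = a" "(\<lambda>x. im a x) \<in> Is" if "I.atom a" for a
    using inv_into_f_f[OF inj] that assms by (auto simp: \<alpha>_def)
  have \<alpha>B: "\<alpha> i \<in> B" if "i \<in> Is" for i using I.atom_B \<alpha>(1) that by blast
  have \<alpha>E: "\<alpha> i \<in> carrier E" if "i \<in> Is" for i using I.B_carrier \<alpha>B that by blast
  have D: "fob ?D x = module_direct_sum Is (\<lambda>i. fob (subfunctor F i) x)" for x
    by (simp add: functor_direct_sum_def)
  have G: "module_functor C S (subfunctor F i)" if "i \<in> Is" for i
  proof -
    have "(\<lambda>x. im (\<alpha> i) x) = i" using \<alpha>(2)[OF that] by auto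
    then show ?thesis
      using summand_artinian_functor[OF \<alpha>B[OF that]] by (simp add: artinian_functor_def)
  qed
  have D_functor: "module_functor C S ?D"
    by (intro functor_direct_sum_module_functor small_category_axioms is_cring G)
  define h where "h x m = (\<lambda>i\<in>Is. \<alpha> i x m)" for x m
  have h_carrier: "h x m \<in> carrier (fob ?D x)" if x: "x \<in> Ob C" and m: "m \<in> carrier (M x)" for x m
  proof -
    obtain T where T: "finite T" "\<And>a m. \<lbrakk>I.atom a; a \<notin> T; m \<in> carrier (M x)\<rbrakk> \<Longrightarrow> a x m = \<zero>\<^bsub>M x\<^esub>"
      using finite_atoms[OF x] by metis
    have "{i \<in> Is. \<alpha> i x m \<noteq> \<zero>\<^bsub>M x\<^esub>} \<subseteq> (\<lambda>a x. im a x) ` T"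
    proof
      fix i assume i: "i \<in> {i \<in> Is. \<alpha> i x m \<noteq> \<zero>\<^bsub>M x\<^esub>}"
      then have "\<alpha> i \<in> T" using T(2)[of "\<alpha> i" m] \<alpha>(1) m by blast
      moreover have "i = (\<lambda>x. im (\<alpha> i) x)" using \<alpha>(2) i by auto
      ultimately show "i \<in> (\<lambda>a x. im a x) ` T" by blast
    qed
    then have "finite {i \<in> Is. \<alpha> i x m \<noteq> \<zero>\<^bsub>M x\<^esub>}" using T(1) finite_subset by blast
    moreover have "\<alpha> i x m \<in> i x" if "i \<in> Is" for i using \<alpha>(2)[OF that, of x] m by blast
    ultimately show ?thesis by (auto simp: D module_direct_sum_def h_def cong: conj_cong)
  qed
  define \<eta> where "\<eta> = (\<lambda>x\<in>Ob C. \<lambda>m\<in>carrier (M x). h x m)"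
  have \<eta>x: "\<eta> x m = h x m" if "x \<in> Ob C" "m \<in> carrier (M x)" for x m using that by (simp add: \<eta>_def)
  have \<eta>: "\<eta> \<in> nat_trans C S F ?D" unfolding \<eta>_def
  proof (rule nat_transI[OF small_category_axioms module_functor_axioms])
    fix x assume x: "x \<in> Ob C"
    show "h x \<in> mod_hom S (M x) (fob ?D x)"
      using x h_carrier
      by (intro mod_homI) (auto simp: h_def D module_direct_sum_def E_apply \<alpha>E intro!: restrict_ext)
  next
    fix f m assume "f \<in> Ar C" "m \<in> carrier (M (Dom C f))"
    then show "h (Cod C f) (far F f m) = far ?D f (h (Dom C f) m)"
      by (auto simp: h_def functor_direct_sum_def E_natural \<alpha>E intro!: restrict_ext)
  qed
  have "bij_betw (\<eta> x) (carrier (M x)) (carrier (fob ?D x))" if x: "x \<in> Ob C" for x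
  proof -
    interpret Mx: module S "M x" using fob_module[OF x] .
    obtain T where T: "finite T" "\<And>a. a \<in> T \<Longrightarrow> I.atom a"
      "\<And>m. m \<in> carrier (M x) \<Longrightarrow> (\<Oplus>\<^bsub>M x\<^esub>a\<in>T. a x m) = m"
      "\<And>a m. \<lbrakk>I.atom a; a \<notin> T; m \<in> carrier (M x)\<rbrakk> \<Longrightarrow> a x m = \<zero>\<^bsub>M x\<^esub>"
      by (rule finite_atoms[OF x]) (rule that)
    have "inj_on (\<eta> x) (carrier (M x))"
    proof (rule inj_onI)
      fix m n assume mn: "m \<in> carrier (M x)" "n \<in> carrier (M x)" "\<eta> x m = \<eta> x n"
      have "a x m = a x n" if "a \<in> T" for a
        using fun_cong[OF mn(3), of "\<lambda>x. im a x"] \<alpha>_im[OF T(2)[OF that]] mn(1,2) x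
        by (simp add: \<eta>x h_def)
      then have "(\<Oplus>\<^bsub>M x\<^esub>a\<in>T. a x m) = (\<Oplus>\<^bsub>M x\<^esub>a\<in>T. a x n)"
        using B_closed[OF I.atom_B[OF T(2)] x] mn(2) by (intro Mx.M.finsum_cong') auto
      then show "m = n" using T(3) mn by simp
    qed
    moreover have "w \<in> \<eta> x ` carrier (M x)" if w: "w \<in> carrier (fob ?D x)" for w
    proof -
      have wi: "w i \<in> i x" if "i \<in> Is" for i
        using w that by (auto simp: D module_direct_sum_def)
      have wc: "w i \<in> carrier (M x)" "\<alpha> i x (w i) = w i" if i: "i \<in> Is" for i
      proof -
        have "w i \<in> im (\<alpha> i) x" using wi[OF i] \<alpha>(2)[OF i] by simp
        then show "w i \<in> carrier (M x)" "\<alpha> i x (w i) = w i"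
          using B_closed[OF \<alpha>B[OF i] x] B_idem_apply[OF \<alpha>B[OF i] x] by auto
      qed
      define v where "v a = w (\<lambda>x. im a x)" for a
      have v: "v a \<in> carrier (M x)" "a x (v a) = v a" if "a \<in> T" for a
        using wc[OF \<alpha>_im(2)[OF T(2)[OF that]]] \<alpha>_im(1)[OF T(2)[OF that]] by (simp_all add: v_def)
      \<comment> \<open>The preimage of \<open>w\<close> adds up the components of \<open>w\<close>
        at the atoms in \<open>T\<close>; orthogonality lets each atom read off its own
        component.\<close>
      define m where "m = (\<Oplus>\<^bsub>M x\<^esub>a\<in>T. v a)"
      have m: "m \<in> carrier (M x)" unfolding m_def using v by (intro Mx.M.finsum_closed) auto
      have "\<alpha> i x m = w i" if i: "i \<in> Is" for i
      proof (cases "\<alpha> i \<in> T")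
        case True
        have "i = (\<lambda>x. im (\<alpha> i) x)" using \<alpha>(2)[OF i] by auto
        then have vi: "v (\<alpha> i) = w i" unfolding v_def by simp
        have "\<alpha> i x (v a) = (if \<alpha> i = a then v a else \<zero>\<^bsub>M x\<^esub>)" if a: "a \<in> T" for a
        proof (cases "\<alpha> i = a")
          case False
          have "\<alpha> i x (a x (v a)) = \<zero>\<^bsub>M x\<^esub>"
            using I.atoms_orthogonal[OF \<alpha>(1)[OF i] T(2)[OF a] False]
              E_mult[OF x v(1)[OF a], of "\<alpha> i" a] E_zero[OF x v(1)[OF a]] by simp
          then show ?thesis using False v(2)[OF a] by simp
        qed (use v a in simp)
        then have "(\<Oplus>\<^bsub>M x\<^esub>a\<in>T. \<alpha> i x (v a)) = (\<Oplus>\<^bsub>M x\<^esub>a\<in>T. if \<alpha> i = a then v a else \<zero>\<^bsub>M x\<^esub>)"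
          using v by (intro Mx.M.finsum_cong') auto
        also have "\<dots> = v (\<alpha> i)" using v by (intro Mx.M.finsum_singleton True T(1)) auto
        finally show ?thesis
          using E_apply_finsum[OF \<alpha>E[OF i] x T(1), of v] v vi by (simp add: m_def)
      next
        case False
        \<comment> \<open>An atom outside \<open>T\<close> vanishes at \<open>x\<close>. As it fixes
          \<open>w i\<close>, that component is zero, in agreement with its value at
          \<open>m\<close>.\<close>
        then show ?thesis using T(4)[OF \<alpha>(1)[OF i] False] wc[OF i] m by metis
      qed
      then have "\<eta> x m = w" using w x m
        by (auto simp: \<eta>x h_def D module_direct_sum_def PiE_iff extensional_def intro!: ext)
      then show ?thesis using m by blast
    qed
    ultimately show ?thesis using h_carrier x \<eta>x by (auto simp: bij_betw_def)
  qed
  then show ?thesis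
    using nat_trans_inverse[OF module_functor_axioms D_functor \<eta>] \<eta> unfolding functor_iso_def by blast
qed

end

theorem corollary5p10:
  fixes C :: "('o, 'a) cat" and S :: "('s, 't) ring_scheme"
    and F :: "('o, 'a, 's, 'm) mod_functor"
  assumes "cring S"
    and "small_category C"
    and "module_functor C S F"
    and "\<And>x. x \<in> Ob C \<Longrightarrow> artinian_module S (fob F x)"
  shows "\<exists>(I :: ('o \<Rightarrow> 'm set) set) (G :: ('o \<Rightarrow> 'm set) \<Rightarrow> ('o, 'a, 's, 'm) mod_functor).
    (\<forall>i\<in>I. strongly_indecomposable C S (G i)) \<and>
    functor_iso C S F (functor_direct_sum I G)"
proof -
  interpret artinian_functor C S F
    using assms by (simp add: artinian_functor_def artinian_functor_axioms_def)
  obtain B where "maximal_idempotents (end_ring C S F) B"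
    using E.maximal_idempotents_exist by blast
  then interpret artinian_functor_idempotents C S F B
    by (simp add: artinian_functor_idempotents_def artinian_functor_axioms)
  show ?thesis
    using summand_strongly_indecomposable decomposition[OF refl]
    by (intro exI[of _ "(\<lambda>a x. im a x) ` Collect I.atom"] exI[of _ "subfunctor F"]) auto
qed

end
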